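(* Let $\mathscr A$ be an algebra of subsets of a nonempty set $\Omega$, and let $\lambda\in ba(\mathscr A)_+$. Let $\mathcal K\subset L^1(\lambda)$ be convex with $0\in\mathcal K$, write $\mathcal C=\mathcal K-\mathscr S(\mathscr A)_+=\{k-s:k\in\mathcal K,\ s\in\mathscr S(\mathscr A)_+\}$ and denote by $\overline{\mathcal C}$ the closure of $\mathcal C$ in $L^1(\lambda)$. The following are equivalent: (i) for each $f\in L^1(\lambda)_+$ with $\int f\,d\lambda>0$ there exists $\eta>0$ such that $\eta f\notin\overline{\mathcal C}$; (ii) for each $A\in\mathscr A$ with $\lambda(A)>0$ there exists $d>0$ such that $d\,\mathbf 1_A\notin\overline{\mathcal C}$; (iii) there exists a finitely additive probability $P$ on $\mathscr A$ such that (a) $\mathcal K\subset L^1(P)$ and $\sup_{k\in\mathcal K}\int k\,dP<\infty$, (b) $\sup_{\{A\in\mathscr A:\lambda(A)>0\}}P(A)/\lambda(A)<\infty$, and (c) for every $A\in\mathscr A$, $P(A)=0$ if and only if $\lambda(A)=0$.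
   Context: $ba(\mathscr A)$ denotes the space of bounded, finitely additive real-valued set functions on the algebra $\mathscr A$ (no countable additivity is assumed, and $\mathscr A$ need not be a $\sigma$-algebra); $ba(\mathscr A)_+$ denotes its nonnegative elements. A finitely additive probability on $\mathscr A$ is $P\in ba(\mathscr A)_+$ with $P(\Omega)=1$. $\mathscr S(\mathscr A)$ is the set of $\mathscr A$-simple functions, i.e. finite real linear combinations of indicators $\mathbf 1_A$, $A\in\mathscr A$, and $\mathscr S(\mathscr A)_+$ is the set of its nonnegative elements. Integration is in the sense of Dunford and Schwartz for finitely additive measures. For $\lambda\in ba(\mathscr A)_+$ let $\lambda^*(E)=\inf\{\lambda(A):A\in\mathscr A,\ E\subset A\}$ for $E\subset\Omega$. A sequence $f_n$ converges to $f:\Omega\to\mathbb R$ in $\lambda$-measure if $\lambda^*(\{|f_n-f|>\varepsilon\})\to0$ for every $\varepsilon>0$. A function $f:\Omega\to\mathbb R$ is $\lambda$-integrable if there is a sequence $f_n\in\mathscr S(\mathscr A)$ converging to $f$ in $\lambda$-measure with $\lim_{m,n}\int|f_n-f_m|\,d\lambda=0$; then $\int f\,d\lambda=\lim_n\int f_n\,d\lambda$. $L^1(\lambda)$ is the space of $\lambda$-integrable functions with (semi)norm $\|f\|=\int|f|\,d\lambda$, functions $f,g$ being identified when $f-g$ is $\lambda$-null, i.e. $\lambda^*(\{|f-g|>\varepsilon\})=0$ for all $\varepsilon>0$. ($L^1(\lambda)$ need not be complete.) $L^1(\lambda)_+$ is the set of nonnegative elements of $L^1(\lambda)$. $L^1(P)$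 is defined in the same way with $P$ in place of $\lambda$.
   Formalization: The formal theorem assumes λ(Ω)>0, i.e. λ is nonzero; for λ=0 conditions (i) and (ii) hold vacuously while (iii) is impossible, since (c) with A=Ω contradicts P(Ω)=1. *)

theory Defs
  imports "HOL-Analysis.Analysis"
begin

(* The carrier \<Omega> is a set; set functions matter only on the algebra \<A> and functions only on \<Omega>. *)

definition ba :: "'a set set \<Rightarrow> ('a set \<Rightarrow> real) set" where
  "ba \<A> = {\<mu>. Measure_Space.additive \<A> \<mu> \<and> bounded (\<mu> ` \<A>)}"

definition ba_pos :: "'a set set \<Rightarrow> ('a set \<Rightarrow> real) set" where
  "ba_pos \<A> = {\<mu> \<in> ba \<A>. \<forall>A\<in>\<A>. 0 \<le> \<mu> A}"

definition fa_prob :: "'a set \<Rightarrow> 'a set set \<Rightarrow> ('a set \<Rightarrow> real) \<Rightarrow> bool" where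
  "fa_prob \<Omega> \<A> P \<longleftrightarrow> P \<in> ba_pos \<A> \<and> P \<Omega> = 1"

definition simple_fun :: "'a set \<Rightarrow> 'a set set \<Rightarrow> ('a \<Rightarrow> real) set" where
  "simple_fun \<Omega> \<A> =
     {f. \<exists>I c. finite I \<and> I \<subseteq> \<A> \<and> (\<forall>x\<in>\<Omega>. f x = (\<Sum>A\<in>I. c A * indicator A x))}"

definition simple_fun_pos :: "'a set \<Rightarrow> 'a set set \<Rightarrow> ('a \<Rightarrow> real) set" where
  "simple_fun_pos \<Omega> \<A> = {f \<in> simple_fun \<Omega> \<A>. \<forall>x\<in>\<Omega>. 0 \<le> f x}"

(* Integral of a simple function, written over its (finitely many) values,
   so that it does not depend on a representation. *)
definition simple_fun_integral :: "'a set \<Rightarrow> ('a set \<Rightarrow> real) \<Rightarrow> ('a \<Rightarrow> real) \<Rightarrow> real" where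
  "simple_fun_integral \<Omega> \<mu> f = (\<Sum>y\<in>f ` \<Omega>. y * \<mu> {x \<in> \<Omega>. f x = y})"

definition outer :: "'a set set \<Rightarrow> ('a set \<Rightarrow> real) \<Rightarrow> 'a set \<Rightarrow> real" where
  "outer \<A> \<mu> E = (INF A\<in>{A \<in> \<A>. E \<subseteq> A}. \<mu> A)"

definition conv_in_measure ::
  "'a set \<Rightarrow> 'a set set \<Rightarrow> ('a set \<Rightarrow> real) \<Rightarrow> (nat \<Rightarrow> 'a \<Rightarrow> real) \<Rightarrow> ('a \<Rightarrow> real) \<Rightarrow> bool" where
  "conv_in_measure \<Omega> \<A> \<mu> F f \<longleftrightarrow>
     (\<forall>\<epsilon>>0. (\<lambda>n. outer \<A> \<mu> {x \<in> \<Omega>. \<bar>F n x - f x\<bar> > \<epsilon>}) \<longlonglongrightarrow> 0)"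

definition determining ::
  "'a set \<Rightarrow> 'a set set \<Rightarrow> ('a set \<Rightarrow> real) \<Rightarrow> (nat \<Rightarrow> 'a \<Rightarrow> real) \<Rightarrow> ('a \<Rightarrow> real) \<Rightarrow> bool" where
  "determining \<Omega> \<A> \<mu> F f \<longleftrightarrow>
     (\<forall>n. F n \<in> simple_fun \<Omega> \<A>) \<and> conv_in_measure \<Omega> \<A> \<mu> F f \<and>
     (\<forall>\<epsilon>>0. \<exists>N. \<forall>m\<ge>N. \<forall>n\<ge>N. simple_fun_integral \<Omega> \<mu> (\<lambda>x. \<bar>F n x - F m x\<bar>) < \<epsilon>)"

(* For \<mu> in ba_pos the limit exists and is the same for every determining sequence. *)
definition fa_integral ::
  "'a set \<Rightarrow> 'a set set \<Rightarrow> ('a set \<Rightarrow> real) \<Rightarrow> ('a \<Rightarrow> real) \<Rightarrow> real" where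
  "fa_integral \<Omega> \<A> \<mu> f =
     (THE I. \<exists>F. determining \<Omega> \<A> \<mu> F f \<and> (\<lambda>n. simple_fun_integral \<Omega> \<mu> (F n)) \<longlonglongrightarrow> I)"

(* Elements of L1 are represented by functions; null_eq is the identification of functions.
   Notions concerning elements of L1 (nonnegativity, convexity, containing 0) are
   taken modulo null_eq below, i.e. they are the notions for the classes. *)
definition L1 :: "'a set \<Rightarrow> 'a set set \<Rightarrow> ('a set \<Rightarrow> real) \<Rightarrow> ('a \<Rightarrow> real) set" where
  "L1 \<Omega> \<A> \<mu> = {f. \<exists>F. determining \<Omega> \<A> \<mu> F f}"

definition null_eq ::
  "'a set \<Rightarrow> 'a set set \<Rightarrow> ('a set \<Rightarrow> real) \<Rightarrow> ('a \<Rightarrow> real) \<Rightarrow> ('a \<Rightarrow> real) \<Rightarrow> bool" where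
  "null_eq \<Omega> \<A> \<mu> f g \<longleftrightarrow> (\<forall>\<epsilon>>0. outer \<A> \<mu> {x \<in> \<Omega>. \<bar>f x - g x\<bar> > \<epsilon>} = 0)"

definition L1_pos :: "'a set \<Rightarrow> 'a set set \<Rightarrow> ('a set \<Rightarrow> real) \<Rightarrow> ('a \<Rightarrow> real) set" where
  "L1_pos \<Omega> \<A> \<mu> = {f \<in> L1 \<Omega> \<A> \<mu>. \<exists>g. (\<forall>x\<in>\<Omega>. 0 \<le> g x) \<and> null_eq \<Omega> \<A> \<mu> f g}"

definition L1_norm ::
  "'a set \<Rightarrow> 'a set set \<Rightarrow> ('a set \<Rightarrow> real) \<Rightarrow> ('a \<Rightarrow> real) \<Rightarrow> real" where
  "L1_norm \<Omega> \<A> \<mu> f = fa_integral \<Omega> \<A> \<mu> (\<lambda>x. \<bar>f x\<bar>)"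

definition L1_closure ::
  "'a set \<Rightarrow> 'a set set \<Rightarrow> ('a set \<Rightarrow> real) \<Rightarrow> ('a \<Rightarrow> real) set \<Rightarrow> ('a \<Rightarrow> real) set" where
  "L1_closure \<Omega> \<A> \<mu> C =
     {f \<in> L1 \<Omega> \<A> \<mu>. \<forall>\<epsilon>>0. \<exists>c\<in>C. L1_norm \<Omega> \<A> \<mu> (\<lambda>x. f x - c x) < \<epsilon>}"

definition L1_convex ::
  "'a set \<Rightarrow> 'a set set \<Rightarrow> ('a set \<Rightarrow> real) \<Rightarrow> ('a \<Rightarrow> real) set \<Rightarrow> bool" where
  "L1_convex \<Omega> \<A> \<mu> K \<longleftrightarrow>
     (\<forall>f\<in>K. \<forall>g\<in>K. \<forall>t. 0 \<le> t \<and> t \<le> 1 \<longrightarrow>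
        (\<exists>h\<in>K. null_eq \<Omega> \<A> \<mu> (\<lambda>x. (1 - t) * f x + t * g x) h))"

definition minus_simple ::
  "'a set \<Rightarrow> 'a set set \<Rightarrow> ('a \<Rightarrow> real) set \<Rightarrow> ('a \<Rightarrow> real) set" where
  "minus_simple \<Omega> \<A> K = {\<lambda>x. k x - s x | k s. k \<in> K \<and> s \<in> simple_fun_pos \<Omega> \<A>}"

end

theory Submission
  imports Defs "HOL-Library.Function_Algebras"
begin

text \<open>
  The substance is the construction of \<open>P\<close> from (ii). If \<open>d 1\<^sub>A\<close> lies outside the closure, the Hahn-Banach
  theorem gives a continuous linear functional on \<open>L\<^sup>1(\<lambda>)\<close> that is bounded on \<open>\<K>\<close>, nonnegative on nonnegative
  simple functions and positive at \<open>1\<^sub>A\<close>. Restricted to indicators it is a set function dominated by a multiple of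
  \<open>\<lambda>\<close>. A Halmos-Savage argument without countable additivity finds countably many such functionals that
  together charge every \<open>A \<in> \<A>\<close> with \<open>\<lambda> A > 0\<close>, and a weighted series of them, normalised, is \<open>P\<close>.
  For (i) from (ii), an integrable \<open>f \<ge> 0\<close> with positive integral dominates some \<open>\<delta> 1\<^sub>A\<close> with \<open>\<lambda> A > 0\<close>,
  and the closure is stable under subtracting nonnegative integrable functions.\<close>

section \<open>Hahn-Banach separation in a seminormed space\<close>

text \<open>\<open>L1\<close> need not be complete and its dual need not consist of bounded
  densities, so \<open>P\<close> is not sought as a density with respect to \<lambda>. Functionals
  are used directly: if \<nu> is dominated by a multiple of \<lambda>, a sequence determining
  \<open>f\<close> for \<lambda> also determines \<open>f\<close> for \<nu>, and density of the
  simple functions identifies the functional with the \<nu>-integral. This is the source of (b); in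
  the converse, (b) and (c) restore the domination and carry approximation in \<open>L1\<close> over
  to \<open>P\<close>. No quotient by null functions is formed. Functions are vectors pointwise,
  whence this instance, and \<open>L1\<close> is a subspace with a seminorm. Convexity of
  \<open>K\<close> and membership of 0 then hold only up to seminorm zero, which the separation
  theorem has to tolerate. It is enough to separate weakly, with values at most 1 on the convex set
  and at least 1 at the point, since only positivity at the indicator is wanted. Each indicator
  yields its own functional, with its own norm and its own bound on \<open>K\<close>. A countable
  family is required because a series can be weighted so that both kinds of bounds become
  summable.\<close>

instantiation "fun" :: (type, real_vector) real_vector
begin

definition scaleR_fun :: "real \<Rightarrow> ('a \<Rightarrow> 'b) \<Rightarrow> 'a \<Rightarrow> 'b" where
  "scaleR_fun a f = (\<lambda>x. a *\<^sub>R f x)"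

instance
  by standard (simp_all add: scaleR_fun_def plus_fun_def scaleR_add_right scaleR_add_left)

end

definition sublinear_on :: "'v::real_vector set \<Rightarrow> ('v \<Rightarrow> real) \<Rightarrow> bool" where
  "sublinear_on V p \<longleftrightarrow>
     (\<forall>x\<in>V. \<forall>y\<in>V. p (x + y) \<le> p x + p y) \<and> (\<forall>x\<in>V. \<forall>a>0. p (a *\<^sub>R x) \<le> a * p x)"

definition linear_functional_on :: "'v::real_vector set \<Rightarrow> ('v \<Rightarrow> real) \<Rightarrow> bool" where
  "linear_functional_on V \<phi> \<longleftrightarrow>
     (\<forall>x\<in>V. \<forall>y\<in>V. \<phi> (x + y) = \<phi> x + \<phi> y) \<and> (\<forall>x\<in>V. \<forall>a. \<phi> (a *\<^sub>R x) = a * \<phi> x)"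

lemma sublinear_on_add: "sublinear_on V p \<Longrightarrow> x \<in> V \<Longrightarrow> y \<in> V \<Longrightarrow> p (x + y) \<le> p x + p y"
  by (simp add: sublinear_on_def)

lemma sublinear_on_zero:
  assumes "subspace V" "sublinear_on V p"
  shows "p 0 = 0"
proof -
  have "0 \<in> V" using assms(1) by (rule subspace_0)
  then have "\<forall>a>0. p 0 \<le> a * p 0"
    using assms(2) unfolding sublinear_on_def by force
  then have "p 0 \<le> 2 * p 0" "p 0 \<le> (1/2) * p 0" by (meson zero_less_numeral half_gt_zero zero_less_one)+
  then show ?thesis by simp
qed

text \<open>The definition asks for one inequality only; applied with \<open>inverse a\<close> to
  the scaled vector it gives the reverse one.\<close>

lemma sublinear_on_scaleR:
  assumes V: "subspace V" and p: "sublinear_on V p" and x: "x \<in> V" and a: "0 \<le> a"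
  shows "p (a *\<^sub>R x) = a * p x"
proof (cases "a = 0")
  case True
  then show ?thesis using sublinear_on_zero[OF V p] by simp
next
  case False
  then have a: "a > 0" using a by simp
  have "p (inverse a *\<^sub>R (a *\<^sub>R x)) \<le> inverse a * p (a *\<^sub>R x)"
    using p positive_imp_inverse_positive[OF a] subspace_scale[OF V x]
    unfolding sublinear_on_def by blast
  then have "a * p x \<le> p (a *\<^sub>R x)" using a by (simp add: field_simps)
  moreover have "p (a *\<^sub>R x) \<le> a * p x" using p a x unfolding sublinear_on_def by simp
  ultimately show ?thesis by simp
qed

lemma sublinear_on_minus:
  assumes V: "subspace V" and p: "sublinear_on V p" and x: "x \<in> V"
  shows "- p (- x) \<le> p x"
  using sublinear_on_add[OF p x subspace_neg[OF V x]] sublinear_on_zero[OF V p] by simp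

text \<open>The purpose is the value at \<open>- g\<close>: the choice \<open>t = 1\<close> bounds
  it by \<open>- p g\<close>, while \<open>t = 0\<close> keeps the functional below
  \<open>p\<close>. The value 0 outside \<open>V\<close> is the normalisation used for the minimal
  functional below.\<close>

definition dir_min :: "'v::real_vector set \<Rightarrow> ('v \<Rightarrow> real) \<Rightarrow> 'v \<Rightarrow> 'v \<Rightarrow> real" where
  "dir_min V p g x = (if x \<in> V then INF t\<in>{0..}. p (x + t *\<^sub>R g) - t * p g else 0)"

text \<open>The infimum is finite because subadditivity, applied to \<open>x + t *\<^sub>R g\<close>
  and \<open>- x\<close>, gives the lower bound \<open>- p (- x)\<close> for every
  \<open>t\<close>.\<close>

lemma dir_min_le:
  assumes V: "subspace V" and p: "sublinear_on V p" and g: "g \<in> V" and x: "x \<in> V" and t: "0 \<le> t"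
  shows "dir_min V p g x \<le> p (x + t *\<^sub>R g) - t * p g"
proof -
  have "- p (- x) \<le> p (x + t *\<^sub>R g) - t * p g" if "t \<ge> 0" for t
    using sublinear_on_add[OF p, of "x + t *\<^sub>R g" "- x"] sublinear_on_scaleR[OF V p g that]
      subspace_add[OF V x subspace_scale[OF V g]] subspace_neg[OF V x] by simp
  then have "bdd_below ((\<lambda>t. p (x + t *\<^sub>R g) - t * p g) ` {0..})"
    by (intro bdd_belowI2) auto
  then show ?thesis unfolding dir_min_def using x t by (auto intro: cINF_lower)
qed

lemma dir_min_sublinear:
  assumes V: "subspace V" and p: "sublinear_on V p" and g: "g \<in> V"
  shows "sublinear_on V (dir_min V p g)"
proof -
  let ?d = "dir_min V p g"
  have greatest: "m \<le> ?d x" if "x \<in> V" "\<And>t. t \<ge> 0 \<Longrightarrow> m \<le> p (x + t *\<^sub>R g) - t * p g" for x m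
    using that unfolding dir_min_def by (auto intro!: cINF_greatest)
  have "?d (x + y) \<le> ?d x + ?d y" if x: "x \<in> V" and y: "y \<in> V" for x y
  proof -
    have *: "?d (x + y) \<le> (p (x + t *\<^sub>R g) - t * p g) + (p (y + s *\<^sub>R g) - s * p g)"
      if "t \<ge> 0" "s \<ge> 0" for t s
    proof -
      have "?d (x + y) \<le> p (x + y + (t + s) *\<^sub>R g) - (t + s) * p g"
        using dir_min_le[OF V p g subspace_add[OF V x y], of "t + s"] that by simp
      also have "x + y + (t + s) *\<^sub>R g = (x + t *\<^sub>R g) + (y + s *\<^sub>R g)"
        by (simp add: algebra_simps)
      also have "p \<dots> \<le> p (x + t *\<^sub>R g) + p (y + s *\<^sub>R g)"
        by (intro sublinear_on_add[OF p] subspace_add[OF V] subspace_scale[OF V] x y g)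
      finally show ?thesis by (simp add: algebra_simps)
    qed
    have "?d (x + y) - (p (x + t *\<^sub>R g) - t * p g) \<le> ?d y" if "t \<ge> 0" for t
      using *[OF that] by (intro greatest y) (simp add: algebra_simps)
    then have "?d (x + y) - ?d y \<le> ?d x"
      by (intro greatest x) (simp add: algebra_simps)
    then show ?thesis by simp
  qed
  moreover have "?d (a *\<^sub>R x) \<le> a * ?d x" if x: "x \<in> V" and a: "a > 0" for x a
  proof -
    have "?d (a *\<^sub>R x) / a \<le> p (x + t *\<^sub>R g) - t * p g" if t: "t \<ge> 0" for t
    proof -
      have "?d (a *\<^sub>R x) \<le> p (a *\<^sub>R x + (a * t) *\<^sub>R g) - (a * t) * p g"
        using a t by (intro dir_min_le[OF V p g]) (auto simp: subspace_scale[OF V x])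
      also have "a *\<^sub>R x + (a * t) *\<^sub>R g = a *\<^sub>R (x + t *\<^sub>R g)"
        by (simp add: algebra_simps)
      also have "p \<dots> = a * p (x + t *\<^sub>R g)"
        using a by (intro sublinear_on_scaleR[OF V p] subspace_add[OF V] subspace_scale[OF V] x g) auto
      finally show ?thesis using a by (simp add: field_simps)
    qed
    then have "?d (a *\<^sub>R x) / a \<le> ?d x" by (rule greatest[OF x])
    then show ?thesis using a by (simp add: field_simps)
  qed
  ultimately show ?thesis by (auto simp: sublinear_on_def)
qed

text \<open>A pointwise minimal sublinear functional \<open>p\<close> is linear, since \<open>dir_min V p g\<close>
  cannot be strictly smaller than \<open>p\<close>.\<close>

lemma linear_functional_below_sublinear:
  fixes q :: "'v::real_vector \<Rightarrow> real"
  assumes V: "subspace V" and q: "sublinear_on V q"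
  obtains \<phi> where "linear_functional_on V \<phi>" "\<And>x. x \<in> V \<Longrightarrow> \<phi> x \<le> q x"
proof -
  \<comment> \<open>Vanishing outside \<open>V\<close> makes a member of \<open>S\<close> determined
    by its values on \<open>V\<close>, as antisymmetry of the order requires.\<close>
  define S where "S = {p. sublinear_on V p \<and> (\<forall>x\<in>V. p x \<le> q x) \<and> (\<forall>x. x \<notin> V \<longrightarrow> p x = 0)}"
  \<comment> \<open>The order is reversed, so that a maximal element from Zorn's lemma is a minimal
    functional.\<close>
  define R where "R p r \<longleftrightarrow> (\<forall>x\<in>V. r x \<le> p x)" for p r :: "'v \<Rightarrow> real"
  have po: "partial_order_on S (relation_of R S)"
  proof (rule partial_order_on_relation_ofI)
    show "a = b" if "a \<in> S" "b \<in> S" "R a b" "R b a" for a b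
    proof
      fix x show "a x = b x"
        using that by (cases "x \<in> V") (auto simp: S_def R_def intro: antisym)
    qed
  qed (auto simp: R_def intro: order_trans)
  \<comment> \<open>A lower bound in terms of \<open>q\<close> alone, so that infima over chains are
    finite.\<close>
  have lower: "- q (- x) \<le> p x" if "p \<in> S" "x \<in> V" for p x
  proof -
    have "p (- x) \<le> q (- x)" using that subspace_neg[OF V] by (auto simp: S_def)
    then show ?thesis using sublinear_on_minus[OF V, of p x] that by (auto simp: S_def)
  qed
  have chains: "\<exists>u\<in>S. \<forall>a\<in>C. R a u" if C: "C \<in> Chains (relation_of R S)" for C
  proof (cases "C = {}")
    case True
    have "(\<lambda>x. if x \<in> V then q x else 0) \<in> S"
      using q subspace_add[OF V] subspace_scale[OF V] by (auto simp: S_def sublinear_on_def)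
    then show ?thesis using True by auto
  next
    case False
    have CS: "C \<subseteq> S" using C by (auto simp: Chains_def relation_of_def)
    have chain: "R a b \<or> R b a" if "a \<in> C" "b \<in> C" for a b
      using C that by (auto simp: Chains_def relation_of_def)
    define u where "u x = (if x \<in> V then INF p\<in>C. p x else 0)" for x
    have bdd: "bdd_below ((\<lambda>p. p x) ` C)" if "x \<in> V" for x
      using lower CS that by (intro bdd_belowI2) blast
    have le: "u x \<le> p x" if "p \<in> C" "x \<in> V" for p x
      using cINF_lower[OF bdd] that by (simp add: u_def)
    have gr: "m \<le> u x" if "x \<in> V" "\<And>p. p \<in> C \<Longrightarrow> m \<le> p x" for x m
      unfolding u_def using that cINF_greatest[OF False, of m "\<lambda>p. p x"] by simp
    have sub: "sublinear_on V p" if "p \<in> C" for p using that CS by (auto simp: S_def)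
    have "u (x + y) \<le> u x + u y" if x: "x \<in> V" and y: "y \<in> V" for x y
    proof -
      have *: "u (x + y) \<le> a x + b y" if ab: "a \<in> C" "b \<in> C" for a b
      proof -
        \<comment> \<open>In a chain one of \<open>a\<close> and \<open>b\<close> lies below the
          other, and its own subadditivity then serves for both.\<close>
        obtain c where c: "c \<in> C" "c x \<le> a x" "c y \<le> b y"
          using chain[OF ab] ab x y by (auto simp: R_def)
        have "u (x + y) \<le> c (x + y)" using le[OF c(1) subspace_add[OF V x y]] .
        also have "\<dots> \<le> c x + c y" by (rule sublinear_on_add[OF sub[OF c(1)] x y])
        finally show ?thesis using c by simp
      qed
      have "u (x + y) - a x \<le> u y" if "a \<in> C" for a
        using *[OF that] by (intro gr y) (simp add: algebra_simps)
      then have "u (x + y) - u y \<le> u x" by (intro gr x) (simp add: algebra_simps)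
      then show ?thesis by simp
    qed
    moreover have "u (a *\<^sub>R x) \<le> a * u x" if x: "x \<in> V" and a: "a > 0" for a x
    proof -
      have "u (a *\<^sub>R x) / a \<le> p x" if "p \<in> C" for p
        using le[OF that subspace_scale[OF V x], of a] sublinear_on_scaleR[OF V sub[OF that] x, of a] a
        by (simp add: field_simps)
      then have "u (a *\<^sub>R x) / a \<le> u x" by (rule gr[OF x])
      then show ?thesis using a by (simp add: field_simps)
    qed
    moreover have "u x \<le> q x" if "x \<in> V" for x
    proof -
      obtain p where "p \<in> C" using False by auto
      then show ?thesis using le[of p x] that CS by (force simp: S_def)
    qed
    ultimately have "u \<in> S" by (auto simp: S_def sublinear_on_def u_def)
    then show ?thesis using le by (auto simp: R_def)
  qed
  obtain p where p: "p \<in> S" and min: "\<And>a. a \<in> S \<Longrightarrow> R p a \<Longrightarrow> a = p"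
    using predicate_Zorn[OF po chains] by blast
  have sub: "sublinear_on V p" using p by (auto simp: S_def)
  have eq: "dir_min V p g = p" if g: "g \<in> V" for g
  proof (rule min)
    have le: "dir_min V p g x \<le> p x" if "x \<in> V" for x
      using dir_min_le[OF V sub g that, of 0] by simp
    then show "R p (dir_min V p g)" by (simp add: R_def)
    show "dir_min V p g \<in> S"
      using dir_min_sublinear[OF V sub g] p le unfolding S_def
      by (auto simp: dir_min_def[of V p g] intro: order_trans)
  qed
  \<comment> \<open>By minimality, \<open>dir_min_le\<close> with \<open>t = 1\<close> reads
    \<open>p x \<le> p (x + g) - p g\<close>, the half of additivity that sublinearity does not
    give.\<close>
  have add: "p (x + g) = p x + p g" if "x \<in> V" "g \<in> V" for x g
    using dir_min_le[OF V sub that(2,1), of 1] eq[OF that(2)] sublinear_on_add[OF sub that] by simp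
  have neg: "p (- x) = - p x" if "x \<in> V" for x
    using add[OF that subspace_neg[OF V that]] sublinear_on_zero[OF V sub] by simp
  have "p (a *\<^sub>R x) = a * p x" if x: "x \<in> V" for a x
  proof (cases "a \<ge> 0")
    case True
    then show ?thesis by (rule sublinear_on_scaleR[OF V sub x])
  next
    case False
    then have "p ((- a) *\<^sub>R x) = (- a) * p x" by (intro sublinear_on_scaleR[OF V sub x]) simp
    then show ?thesis using neg[OF subspace_scale[OF V x], of a] by simp
  qed
  then have "linear_functional_on V p" using add by (simp add: linear_functional_on_def)
  then show thesis using that p by (auto simp: S_def)
qed

text \<open>Domination by \<open>dir_min V q g\<close> instead of \<open>q\<close> forces equality
  at \<open>g\<close>: it bounds the functional at \<open>- g\<close> by
  \<open>- q g\<close>.\<close>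

lemma Hahn_Banach_attained:
  fixes q :: "'v::real_vector \<Rightarrow> real"
  assumes V: "subspace V" and q: "sublinear_on V q" and g: "g \<in> V"
  obtains \<phi> where "linear_functional_on V \<phi>" "\<And>x. x \<in> V \<Longrightarrow> \<phi> x \<le> q x" "\<phi> g = q g"
proof -
  obtain \<phi> where \<phi>: "linear_functional_on V \<phi>" "\<And>x. x \<in> V \<Longrightarrow> \<phi> x \<le> dir_min V q g x"
    using linear_functional_below_sublinear[OF V dir_min_sublinear[OF V q g]] by blast
  have le: "\<phi> x \<le> q x" if "x \<in> V" for x
    using \<phi>(2)[OF that] dir_min_le[OF V q g that, of 0] by simp
  have "\<phi> (- g) \<le> - q g"
    using \<phi>(2)[OF subspace_neg[OF V g]] dir_min_le[OF V q g subspace_neg[OF V g], of 1]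
      sublinear_on_zero[OF V q] by simp
  moreover have "\<phi> ((- 1) *\<^sub>R g) = - \<phi> g"
    using \<phi>(1) g unfolding linear_functional_on_def by (metis mult_minus1)
  ultimately have "\<phi> g = q g" using le[OF g] by simp
  with that \<phi>(1) le show thesis by blast
qed

section \<open>Separation of a point from a set that is convex up to seminorm zero\<close>

definition seminorm_on :: "'v::real_vector set \<Rightarrow> ('v \<Rightarrow> real) \<Rightarrow> bool" where
  "seminorm_on V p \<longleftrightarrow>
     (\<forall>x\<in>V. 0 \<le> p x) \<and> (\<forall>x\<in>V. \<forall>y\<in>V. p (x + y) \<le> p x + p y) \<and> (\<forall>x\<in>V. \<forall>a. p (a *\<^sub>R x) = \<bar>a\<bar> * p x)"

text \<open>The functional is dominated by \<open>q x = inf {t + p (x - t c) / \<delta> | t \<ge> 0, c \<in> C}\<close>,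
  for which \<open>q \<le> p / \<delta>\<close>, \<open>q \<le> 1\<close> on \<open>C\<close> and \<open>q g \<ge> 1\<close>.\<close>

lemma seminorm_separation:
  fixes p :: "'v::real_vector \<Rightarrow> real"
  assumes V: "subspace V" and p: "seminorm_on V p" and C: "C \<subseteq> V"
    and convex: "\<And>x y t. x \<in> C \<Longrightarrow> y \<in> C \<Longrightarrow> 0 \<le> t \<Longrightarrow> t \<le> 1 \<Longrightarrow>
        \<exists>z\<in>C. p ((1 - t) *\<^sub>R x + t *\<^sub>R y - z) = 0"
    and zero: "z0 \<in> C" "p z0 = 0"
    and g: "g \<in> V" and \<delta>: "\<delta> > 0" and far: "\<And>c. c \<in> C \<Longrightarrow> \<delta> \<le> p (g - c)"
  obtains \<phi> where "linear_functional_on V \<phi>" "\<And>x. x \<in> V \<Longrightarrow> \<bar>\<phi> x\<bar> \<le> p x / \<delta>"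
    "\<And>c. c \<in> C \<Longrightarrow> \<phi> c \<le> 1" "1 \<le> \<phi> g"
proof -
  note sc = subspace_scale[OF V] and ad = subspace_add[OF V] and di = subspace_diff[OF V]
  have pos: "0 \<le> p x" if "x \<in> V" for x using p that by (simp add: seminorm_on_def)
  have tri: "p (x + y) \<le> p x + p y" if "x \<in> V" "y \<in> V" for x y
    using p that by (simp add: seminorm_on_def)
  have hom: "p (a *\<^sub>R x) = \<bar>a\<bar> * p x" if "x \<in> V" for x a using p that by (simp add: seminorm_on_def)
  have CV: "c \<in> V" if "c \<in> C" for c using C that by auto
  define h where "h x tc = fst tc + p (x - fst tc *\<^sub>R snd tc) / \<delta>" for x and tc :: "real \<times> 'v"
  define q where "q x = (INF tc\<in>{0..} \<times> C. h x tc)" for x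
  have hpos: "0 \<le> h x (t, c)" if "x \<in> V" "t \<ge> 0" "c \<in> C" for x t c
    using pos[OF di[OF that(1) sc[OF CV[OF that(3)]]], of t] that(2) \<delta> by (simp add: h_def)
  have le: "q x \<le> h x (t, c)" if "x \<in> V" "t \<ge> 0" "c \<in> C" for x t c
    unfolding q_def using that hpos[OF that(1)] by (intro cINF_lower bdd_belowI2[where m = 0]) auto
  have gr: "m \<le> q x" if "\<And>t c. t \<ge> 0 \<Longrightarrow> c \<in> C \<Longrightarrow> m \<le> h x (t, c)" for m x
    unfolding q_def using zero that by (intro cINF_greatest) auto
  have combine: "\<exists>c\<in>C. h (x + y) (t + s, c) \<le> h x (t, a) + h y (s, b)"
    if x: "x \<in> V" and y: "y \<in> V" and t: "t \<ge> 0" and s: "s \<ge> 0" and a: "a \<in> C" and b: "b \<in> C"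
    for x y t s a b
  proof (cases "t + s = 0")
    case True
    then have "t = 0" "s = 0" using t s by auto
    then show ?thesis using tri[OF x y] a \<delta> by (auto simp: h_def field_simps intro!: bexI[of _ a])
  next
    case False
    then have ts: "t + s > 0" using t s by simp
    \<comment> \<open>With this weight \<open>t *\<^sub>R a + s *\<^sub>R b\<close> is
      \<open>t + s\<close> times a convex combination of \<open>a\<close> and \<open>b\<close>,
      which agrees with a member of \<open>C\<close> up to the error \<open>?e\<close> of seminorm
      zero.\<close>
    define \<theta> where "\<theta> = s / (t + s)"
    have \<theta>: "0 \<le> \<theta>" "\<theta> \<le> 1" using ts t s by (auto simp: \<theta>_def)
    obtain c where c: "c \<in> C" "p ((1 - \<theta>) *\<^sub>R a + \<theta> *\<^sub>R b - c) = 0"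
      using convex[OF a b \<theta>] by blast
    let ?e = "(1 - \<theta>) *\<^sub>R a + \<theta> *\<^sub>R b - c"
    have e: "?e \<in> V" by (intro di ad sc CV a b c)
    have th: "(t + s) * (1 - \<theta>) = t" "(t + s) * \<theta> = s" using ts by (simp_all add: \<theta>_def field_simps)
    have "(t + s) *\<^sub>R ?e = ((t + s) * (1 - \<theta>)) *\<^sub>R a + ((t + s) * \<theta>) *\<^sub>R b - (t + s) *\<^sub>R c"
      by (simp only: scaleR_diff_right scaleR_add_right scaleR_scaleR)
    then have split: "x + y - (t + s) *\<^sub>R c = (x - t *\<^sub>R a) + (y - s *\<^sub>R b) + (t + s) *\<^sub>R ?e"
      unfolding th by (simp add: algebra_simps)
    have "p (x + y - (t + s) *\<^sub>R c) \<le> p ((x - t *\<^sub>R a) + (y - s *\<^sub>R b)) + p ((t + s) *\<^sub>R ?e)"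
      unfolding split by (intro tri ad di sc x y e CV a b)
    also have "p ((t + s) *\<^sub>R ?e) = 0" using hom[OF e] c by simp
    also have "p ((x - t *\<^sub>R a) + (y - s *\<^sub>R b)) \<le> p (x - t *\<^sub>R a) + p (y - s *\<^sub>R b)"
      by (intro tri di sc x y CV a b)
    finally have "p (x + y - (t + s) *\<^sub>R c) / \<delta> \<le> (p (x - t *\<^sub>R a) + p (y - s *\<^sub>R b)) / \<delta>"
      using \<delta> by (intro divide_right_mono) auto
    then show ?thesis using c(1) by (intro bexI[of _ c]) (auto simp: h_def add_divide_distrib)
  qed
  have "sublinear_on V q"
    unfolding sublinear_on_def
  proof (intro conjI ballI allI impI)
    fix x y assume x: "x \<in> V" and y: "y \<in> V"
    have *: "q (x + y) \<le> h x (t, a) + h y (s, b)" if ab: "t \<ge> 0" "s \<ge> 0" "a \<in> C" "b \<in> C" for t s a b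
    proof -
      obtain c where c: "c \<in> C" "h (x + y) (t + s, c) \<le> h x (t, a) + h y (s, b)"
        using combine[OF x y ab] by blast
      show ?thesis using le[OF ad[OF x y], of "t + s" c] c ab by simp
    qed
    have "q (x + y) - h x (t, a) \<le> q y" if "t \<ge> 0" "a \<in> C" for t a
      using *[OF that(1) _ that(2)] by (intro gr) (simp add: algebra_simps)
    then have "q (x + y) - q y \<le> q x" by (intro gr) (simp add: algebra_simps)
    then show "q (x + y) \<le> q x + q y" by simp
  next
    fix x :: 'v and a :: real assume x: "x \<in> V" and a: "a > 0"
    have "q (a *\<^sub>R x) / a \<le> h x (t, c)" if "t \<ge> 0" "c \<in> C" for t c
    proof -
      have "p (a *\<^sub>R x - (a * t) *\<^sub>R c) = p (a *\<^sub>R (x - t *\<^sub>R c))" by (simp add: algebra_simps)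
      also have "\<dots> = a * p (x - t *\<^sub>R c)" using a hom[OF di[OF x sc[OF CV[OF that(2)]]]] by simp
      finally have "h (a *\<^sub>R x) (a * t, c) = a * h x (t, c)"
        by (simp add: h_def algebra_simps)
      then show ?thesis using le[OF sc[OF x], of "a * t" c a] that a by (simp add: field_simps)
    qed
    then have "q (a *\<^sub>R x) / a \<le> q x" by (rule gr)
    then show "q (a *\<^sub>R x) \<le> a * q x" using a by (simp add: field_simps)
  qed
  then obtain \<phi> where \<phi>: "linear_functional_on V \<phi>" "\<And>x. x \<in> V \<Longrightarrow> \<phi> x \<le> q x" "\<phi> g = q g"
    using Hahn_Banach_attained[OF V _ g] by blast
  have up: "\<phi> x \<le> p x / \<delta>" if "x \<in> V" for x
    using \<phi>(2)[OF that] le[OF that, of 0 z0] zero by (simp add: h_def)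
  have "\<bar>\<phi> x\<bar> \<le> p x / \<delta>" if x: "x \<in> V" for x
  proof -
    have "\<phi> ((- 1) *\<^sub>R x) = - \<phi> x" using \<phi>(1) x unfolding linear_functional_on_def by (metis mult_minus1)
    moreover have "p ((- 1) *\<^sub>R x) = p x" using hom[OF x, of "- 1"] by simp
    ultimately show ?thesis using up[OF x] up[OF sc[OF x, of "- 1"]] by simp
  qed
  moreover have "\<phi> c \<le> 1" if "c \<in> C" for c
  proof -
    have "p 0 = 0" using hom[of 0 0] subspace_0[OF V] by simp
    then show ?thesis using \<phi>(2)[OF CV[OF that]] le[OF CV[OF that], of 1 c] that by (simp add: h_def)
  qed
  moreover have "1 \<le> q g"
  proof (rule gr)
    fix t c assume t: "0 \<le> (t::real)" and c: "c \<in> C"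
    show "1 \<le> h g (t, c)"
    proof (cases "t \<le> 1")
      case True
      \<comment> \<open>For \<open>t \<le> 1\<close> the point \<open>t *\<^sub>R c\<close> is, up
        to seminorm zero, a convex combination of \<open>z0\<close> and \<open>c\<close>, hence as
        far from \<open>g\<close> as the points of \<open>C\<close>. For larger \<open>t\<close> the
        summand \<open>t\<close> of \<open>h\<close> alone exceeds 1.\<close>
      obtain d where d: "d \<in> C" "p ((1 - t) *\<^sub>R z0 + t *\<^sub>R c - d) = 0"
        using convex[OF zero(1) c t True] by blast
      let ?e = "(1 - t) *\<^sub>R z0 + t *\<^sub>R c - d"
      have e: "?e \<in> V" by (intro di ad sc CV zero c d)
      have "\<delta> \<le> p (g - d)" by (rule far[OF d(1)])
      also have "g - d = (g - t *\<^sub>R c) + (?e + (- (1 - t)) *\<^sub>R z0)" by (simp add: algebra_simps)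
      also have "p \<dots> \<le> p (g - t *\<^sub>R c) + p (?e + (- (1 - t)) *\<^sub>R z0)"
        by (intro tri di sc ad e g CV zero c d)
      also have "p (?e + (- (1 - t)) *\<^sub>R z0) \<le> p ?e + p ((- (1 - t)) *\<^sub>R z0)"
        by (intro tri e sc CV zero)
      also have "p ((- (1 - t)) *\<^sub>R z0) = 0" using hom[OF CV[OF zero(1)]] zero(2) by simp
      finally have "1 \<le> p (g - t *\<^sub>R c) / \<delta>" using d(2) \<delta> by (simp add: field_simps)
      then show ?thesis using t by (simp add: h_def)
    next
      case False
      then show ?thesis using pos[OF di[OF g sc[OF CV[OF c]]], of t] \<delta>
        by (simp add: h_def add_increasing2)
    qed
  qed
  ultimately show thesis using that[OF \<phi>(1)] \<phi>(3) by auto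
qed

section \<open>The Dunford-Schwartz integral\<close>

text \<open>The codomain is arbitrary so that a pair of simple functions can be treated as one
  function, whose level sets refine those of both components.\<close>

definition finite_level_sets :: "'a set \<Rightarrow> 'a set set \<Rightarrow> ('a \<Rightarrow> 'b) \<Rightarrow> bool" where
  "finite_level_sets \<Omega> \<A> h \<longleftrightarrow> finite (h ` \<Omega>) \<and> (\<forall>y. {x \<in> \<Omega>. h x = y} \<in> \<A>)"

lemma abs_mult_diff: "\<bar>k * a - k * b\<bar> = \<bar>k\<bar> * \<bar>a - b\<bar>" for k a b :: real
  by (simp flip: right_diff_distrib abs_mult)

text \<open>Boundedness is automatic: splitting \<Omega> into \<open>A\<close> and its complement
  bounds \<open>\<nu> A\<close> by \<open>\<nu> \<Omega>\<close>.\<close>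

lemma ba_posI:
  assumes "algebra \<Omega> \<A>" and add: "\<And>A B. A \<in> \<A> \<Longrightarrow> B \<in> \<A> \<Longrightarrow> A \<inter> B = {} \<Longrightarrow> \<nu> (A \<union> B) = \<nu> A + \<nu> B"
    and pos: "\<And>A. A \<in> \<A> \<Longrightarrow> 0 \<le> \<nu> A"
  shows "\<nu> \<in> ba_pos \<A>"
proof -
  interpret algebra \<Omega> \<A> by fact
  have "norm (\<nu> A) \<le> \<nu> \<Omega>" if A: "A \<in> \<A>" for A
  proof -
    have "\<nu> (A \<union> (\<Omega> - A)) = \<nu> A + \<nu> (\<Omega> - A)" using A by (intro add) auto
    moreover have "A \<union> (\<Omega> - A) = \<Omega>" using sets_into_space[OF A] by auto
    ultimately show ?thesis using pos[OF A] pos[of "\<Omega> - A"] A by auto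
  qed
  then have "bounded (\<nu> ` \<A>)" unfolding bounded_iff by blast
  then show ?thesis using add pos by (simp add: ba_pos_def ba_def additive_def)
qed

section \<open>Nonnegative finitely additive set functions\<close>

locale finitely_additive = algebra \<Omega> \<A> for \<Omega> :: "'a set" and \<A> +
  fixes \<mu> :: "'a set \<Rightarrow> real"
  assumes ba_pos: "\<mu> \<in> ba_pos \<A>"
begin

lemma measure_nonneg: "A \<in> \<A> \<Longrightarrow> 0 \<le> \<mu> A"
  using ba_pos by (simp add: ba_pos_def)

lemma measure_Un: "A \<in> \<A> \<Longrightarrow> B \<in> \<A> \<Longrightarrow> A \<inter> B = {} \<Longrightarrow> \<mu> (A \<union> B) = \<mu> A + \<mu> B"
  using ba_pos by (simp add: ba_pos_def ba_def additive_def)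

lemma measure_empty [simp]: "\<mu> {} = 0"
  using measure_Un[of "{}" "{}"] by simp

lemma measure_split: "A \<in> \<A> \<Longrightarrow> B \<in> \<A> \<Longrightarrow> \<mu> A = \<mu> (A \<inter> B) + \<mu> (A - B)"
  using measure_Un[of "A \<inter> B" "A - B"] by (simp add: Int_Diff_Un Int Diff) blast

lemma measure_mono: "A \<in> \<A> \<Longrightarrow> B \<in> \<A> \<Longrightarrow> A \<subseteq> B \<Longrightarrow> \<mu> A \<le> \<mu> B"
  using measure_split[of B A] measure_nonneg[of "B - A"] by (simp add: Int_absorb1 Diff)

lemma measure_Un_le: "A \<in> \<A> \<Longrightarrow> B \<in> \<A> \<Longrightarrow> \<mu> (A \<union> B) \<le> \<mu> A + \<mu> B"
  using measure_Un[of A "B - A"] measure_mono[of "B - A" B] by (simp add: Diff)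

lemma measure_UNION:
  "finite I \<Longrightarrow> (\<And>i. i \<in> I \<Longrightarrow> B i \<in> \<A>) \<Longrightarrow> disjoint_family_on B I \<Longrightarrow> \<mu> (\<Union>i\<in>I. B i) = (\<Sum>i\<in>I. \<mu> (B i))"
proof (induction I rule: finite_induct)
  case (insert i I)
  have "\<mu> (B i \<union> (\<Union>i\<in>I. B i)) = \<mu> (B i) + \<mu> (\<Union>i\<in>I. B i)"
    using insert by (intro measure_Un finite_UN) (auto simp: disjoint_family_on_def)
  then show ?case using insert by (simp add: disjoint_family_on_def)
qed simp

section \<open>Simple functions and their integral\<close>

abbreviation "simple \<equiv> simple_fun \<Omega> \<A>"
abbreviation "sint \<equiv> simple_fun_integral \<Omega> \<mu>"

lemma finite_level_sets_comp:
  assumes "finite_level_sets \<Omega> \<A> h"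
  shows "finite_level_sets \<Omega> \<A> (\<lambda>x. g (h x))"
  unfolding finite_level_sets_def
proof (intro conjI allI)
  have "(\<lambda>x. g (h x)) ` \<Omega> = g ` h ` \<Omega>" by auto
  then show "finite ((\<lambda>x. g (h x)) ` \<Omega>)" using assms by (simp add: finite_level_sets_def)
  fix y
  have "{x \<in> \<Omega>. g (h x) = y} = (\<Union>z\<in>{z \<in> h ` \<Omega>. g z = y}. {x \<in> \<Omega>. h x = z})" by auto
  also have "\<dots> \<in> \<A>" using assms by (intro finite_UN) (auto simp: finite_level_sets_def)
  finally show "{x \<in> \<Omega>. g (h x) = y} \<in> \<A>" .
qed

lemma finite_level_sets_Pair:
  assumes "finite_level_sets \<Omega> \<A> f" "finite_level_sets \<Omega> \<A> g"
  shows "finite_level_sets \<Omega> \<A> (\<lambda>x. (f x, g x))"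
  unfolding finite_level_sets_def
proof (intro conjI allI)
  have "(\<lambda>x. (f x, g x)) ` \<Omega> \<subseteq> f ` \<Omega> \<times> g ` \<Omega>" by auto
  then show "finite ((\<lambda>x. (f x, g x)) ` \<Omega>)"
    by (rule finite_subset) (use assms in \<open>simp add: finite_level_sets_def\<close>)
  fix y
  have "{x \<in> \<Omega>. (f x, g x) = y} = {x \<in> \<Omega>. f x = fst y} \<inter> {x \<in> \<Omega>. g x = snd y}" by auto
  then show "{x \<in> \<Omega>. (f x, g x) = y} \<in> \<A>" using assms by (simp add: finite_level_sets_def Int)
qed

lemma finite_level_sets_indicator:
  assumes "A \<in> \<A>"
  shows "finite_level_sets \<Omega> \<A> (indicator A :: 'a \<Rightarrow> real)"
  unfolding finite_level_sets_def
proof (intro conjI allI)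
  show "finite ((indicator A :: 'a \<Rightarrow> real) ` \<Omega>)"
    by (rule finite_subset[of _ "{0, 1}"]) (auto simp: indicator_def)
  fix y :: real
  have "{x \<in> \<Omega>. indicator A x = y} = (if y = 1 then A else if y = 0 then \<Omega> - A else {})"
    using sets_into_space[OF assms] by (auto simp: indicator_def)
  then show "{x \<in> \<Omega>. indicator A x = y} \<in> \<A>" using assms by auto
qed

text \<open>Level sets replace linear combinations of indicators, whose sets may overlap. Closure
  under compositions is then immediate, and the integral, a sum over values, can be
  regrouped.\<close>

lemma simple_iff: "f \<in> simple \<longleftrightarrow> finite_level_sets \<Omega> \<A> f"
proof
  assume "f \<in> simple"
  then obtain I c where I: "finite I" "I \<subseteq> \<A>" and f: "\<And>x. x \<in> \<Omega> \<Longrightarrow> f x = (\<Sum>A\<in>I. c A * indicator A x)"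
    by (auto simp: simple_fun_def)
  have "finite_level_sets \<Omega> \<A> (\<lambda>x. \<Sum>A\<in>I. c A * indicator A x :: real)"
    using I
  proof (induction I rule: finite_induct)
    case empty
    then show ?case using finite_level_sets_comp[OF finite_level_sets_indicator[OF top], of "\<lambda>_. 0"] by simp
  next
    case (insert A I)
    then have "finite_level_sets \<Omega> \<A> (\<lambda>x. (indicator A x :: real, \<Sum>A\<in>I. c A * indicator A x :: real))"
      by (intro finite_level_sets_Pair finite_level_sets_indicator) auto
    from finite_level_sets_comp[OF this, of "\<lambda>(u, v). c A * u + v"] show ?case
      by (simp only: sum.insert[OF insert(1,2)] prod.case)
  qed
  moreover have "{x \<in> \<Omega>. f x = y} = {x \<in> \<Omega>. (\<Sum>A\<in>I. c A * indicator A x) = y}" for y using f by auto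
  moreover have "f ` \<Omega> = (\<lambda>x. \<Sum>A\<in>I. c A * indicator A x) ` \<Omega>" using f by auto
  ultimately show "finite_level_sets \<Omega> \<A> f" by (simp add: finite_level_sets_def)
next
  assume f: "finite_level_sets \<Omega> \<A> f"
  let ?L = "\<lambda>y. {x \<in> \<Omega>. f x = y}"
  \<comment> \<open>A coefficient has to be a function of the set, so the value is read off at a
    chosen point; only attained values occur, hence the level sets are nonempty.\<close>
  have val: "f (SOME x'. x' \<in> ?L (f x)) = f x" if "x \<in> \<Omega>" for x
    using someI[of "\<lambda>x'. x' \<in> ?L (f x)" x] that by simp
  have "f x = (\<Sum>A\<in>?L ` f ` \<Omega>. f (SOME x. x \<in> A) * indicator A x)" if x: "x \<in> \<Omega>" for x
  proof -
    have "(\<Sum>A\<in>?L ` f ` \<Omega>. f (SOME x. x \<in> A) * indicator A x) =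
        (\<Sum>A\<in>{?L (f x)}. f (SOME x. x \<in> A) * indicator A x)"
      using f x by (intro sum.mono_neutral_right) (auto simp: finite_level_sets_def indicator_def)
    then show ?thesis using val[OF x] x by simp
  qed
  then have "\<exists>c. \<forall>x\<in>\<Omega>. f x = (\<Sum>A\<in>?L ` f ` \<Omega>. c A * indicator A x)"
    by (intro exI[of _ "\<lambda>A. f (SOME x. x \<in> A)"] ballI)
  moreover have "finite (?L ` f ` \<Omega>)" "?L ` f ` \<Omega> \<subseteq> \<A>" using f by (auto simp: finite_level_sets_def)
  ultimately show "f \<in> simple" unfolding simple_fun_def by blast
qed

lemma simple_comp: "f \<in> simple \<Longrightarrow> (\<lambda>x. \<Phi> (f x)) \<in> simple"
  unfolding simple_iff by (rule finite_level_sets_comp)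

lemma simple_comp2: "f \<in> simple \<Longrightarrow> g \<in> simple \<Longrightarrow> (\<lambda>x. \<Phi> (f x) (g x)) \<in> simple"
  using finite_level_sets_comp[OF finite_level_sets_Pair, of f g "\<lambda>(u, v). \<Phi> u v"]
  by (simp add: simple_iff)

lemma simple_indicator: "A \<in> \<A> \<Longrightarrow> indicator A \<in> simple"
  unfolding simple_iff by (rule finite_level_sets_indicator)

lemma simple_const: "(\<lambda>_. c) \<in> simple"
  using simple_comp[OF simple_indicator[OF top], of "\<lambda>_. c"] .

lemma simple_level_set:
  assumes "f \<in> simple"
  shows "{x \<in> \<Omega>. Q (f x)} \<in> \<A>"
proof -
  have "finite_level_sets \<Omega> \<A> (\<lambda>x. Q (f x))"
    using finite_level_sets_comp[of f Q] assms by (simp add: simple_iff)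
  then have "{x \<in> \<Omega>. Q (f x) = True} \<in> \<A>" unfolding finite_level_sets_def by blast
  then show ?thesis by simp
qed

lemma simple_bounded: "f \<in> simple \<Longrightarrow> \<exists>M>0. \<forall>x\<in>\<Omega>. \<bar>f x\<bar> \<le> M"
proof -
  assume "f \<in> simple"
  then have fin: "finite (f ` \<Omega>)" by (simp add: simple_iff finite_level_sets_def)
  have "\<bar>f x\<bar> \<le> 1 + (\<Sum>y\<in>f ` \<Omega>. \<bar>y\<bar>)" if "x \<in> \<Omega>" for x
    using member_le_sum[of "f x" "f ` \<Omega>" abs] fin that by simp
  moreover have "0 < 1 + (\<Sum>y\<in>f ` \<Omega>. \<bar>y\<bar>)" by (simp add: add_pos_nonneg sum_nonneg)
  ultimately show ?thesis by blast
qed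

text \<open>The integral may be computed over any finer finite partition: the level sets of
  \<open>h\<close> are grouped by the value of \<open>g\<close>, and finite additivity reassembles
  each level set of the composition.\<close>

lemma sint_comp:
  assumes h: "finite_level_sets \<Omega> \<A> h"
  shows "sint (\<lambda>x. g (h x)) = (\<Sum>z\<in>h ` \<Omega>. g z * \<mu> {x \<in> \<Omega>. h x = z})"
proof -
  have fin: "finite (h ` \<Omega>)" and L: "\<And>z. {x \<in> \<Omega>. h x = z} \<in> \<A>" using h by (auto simp: finite_level_sets_def)
  have "(\<Sum>z\<in>h ` \<Omega>. g z * \<mu> {x \<in> \<Omega>. h x = z}) =
      (\<Sum>y\<in>g ` h ` \<Omega>. \<Sum>z\<in>{z \<in> h ` \<Omega>. g z = y}. g z * \<mu> {x \<in> \<Omega>. h x = z})"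
    using fin by (rule sum.image_gen)
  also have "\<dots> = (\<Sum>y\<in>g ` h ` \<Omega>. y * \<mu> {x \<in> \<Omega>. g (h x) = y})"
  proof (rule sum.cong[OF refl])
    fix y assume "y \<in> g ` h ` \<Omega>"
    have "{x \<in> \<Omega>. g (h x) = y} = (\<Union>z\<in>{z \<in> h ` \<Omega>. g z = y}. {x \<in> \<Omega>. h x = z})" by auto
    also have "\<mu> \<dots> = (\<Sum>z\<in>{z \<in> h ` \<Omega>. g z = y}. \<mu> {x \<in> \<Omega>. h x = z})"
      using fin L by (intro measure_UNION) (auto simp: disjoint_family_on_def)
    finally show "(\<Sum>z\<in>{z \<in> h ` \<Omega>. g z = y}. g z * \<mu> {x \<in> \<Omega>. h x = z}) = y * \<mu> {x \<in> \<Omega>. g (h x) = y}"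
      by (simp add: sum_distrib_left)
  qed
  finally show ?thesis by (simp add: simple_fun_integral_def image_image)
qed

lemma
  assumes f: "f \<in> simple" and g: "g \<in> simple"
  shows sint_add: "sint (\<lambda>x. f x + g x) = sint f + sint g"
    and sint_diff: "sint (\<lambda>x. f x - g x) = sint f - sint g"
    and sint_mono: "(\<And>x. x \<in> \<Omega> \<Longrightarrow> f x \<le> g x) \<Longrightarrow> sint f \<le> sint g"
proof -
  \<comment> \<open>The level sets of the pair are a common refinement, over which all the integrals
    in question are sums with the same weights.\<close>
  let ?h = "\<lambda>x. (f x, g x)"
  have h: "finite_level_sets \<Omega> \<A> ?h" using f g unfolding simple_iff by (rule finite_level_sets_Pair)
  note rep = sint_comp[OF h, of "\<lambda>(u, v). u + v"] sint_comp[OF h, of "\<lambda>(u, v). u - v"]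
    sint_comp[OF h, of fst] sint_comp[OF h, of snd]
  show "sint (\<lambda>x. f x + g x) = sint f + sint g" "sint (\<lambda>x. f x - g x) = sint f - sint g"
    using rep by (simp_all add: case_prod_unfold algebra_simps sum.distrib sum_subtractf)
  assume le: "\<And>x. x \<in> \<Omega> \<Longrightarrow> f x \<le> g x"
  have "(\<Sum>z\<in>?h ` \<Omega>. fst z * \<mu> {x \<in> \<Omega>. ?h x = z}) \<le> (\<Sum>z\<in>?h ` \<Omega>. snd z * \<mu> {x \<in> \<Omega>. ?h x = z})"
    using h le by (intro sum_mono mult_right_mono measure_nonneg) (auto simp: finite_level_sets_def)
  then show "sint f \<le> sint g" using rep by simp
qed

lemma sint_cmult: "f \<in> simple \<Longrightarrow> sint (\<lambda>x. c * f x) = c * sint f"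
  using sint_comp[of f "\<lambda>y. c * y"] by (simp add: simple_iff simple_fun_integral_def sum_distrib_left mult.assoc)

lemma sint_indicator: "A \<in> \<A> \<Longrightarrow> sint (indicator A) = \<mu> A"
proof -
  assume A: "A \<in> \<A>"
  have L: "{x \<in> \<Omega>. indicator A x = (1::real)} = A"
    using sets_into_space[OF A] by (auto simp: indicator_def)
  have "sint (indicator A) = (\<Sum>y\<in>{0, 1}. y * \<mu> {x \<in> \<Omega>. indicator A x = y})"
    unfolding simple_fun_integral_def
  proof (rule sum.mono_neutral_left)
    show "\<forall>y\<in>{0, 1} - indicator A ` \<Omega>. y * \<mu> {x \<in> \<Omega>. indicator A x = y} = 0"
    proof
      fix y :: real assume "y \<in> {0, 1} - indicator A ` \<Omega>"
      then have "{x \<in> \<Omega>. indicator A x = y} = {}" by auto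
      then show "y * \<mu> {x \<in> \<Omega>. indicator A x = y} = 0" by (simp only: measure_empty mult_zero_right)
    qed
  qed (auto simp: indicator_def)
  then show ?thesis using L by simp
qed

lemma sint_const: "sint (\<lambda>_. c) = c * \<mu> \<Omega>"
proof -
  have "sint (\<lambda>x. (\<lambda>_. c) (indicator \<Omega> x :: real)) = sint (\<lambda>x. c * indicator \<Omega> x)"
    by (auto simp: simple_fun_integral_def intro!: sum.cong image_cong arg_cong[of _ _ \<mu>])
  then show ?thesis using sint_cmult[OF simple_indicator[OF top], of c] sint_indicator[OF top] by simp
qed

lemma sint_nonneg: "f \<in> simple \<Longrightarrow> (\<And>x. x \<in> \<Omega> \<Longrightarrow> 0 \<le> f x) \<Longrightarrow> 0 \<le> sint f"
  using sint_mono[OF simple_const[of 0], of f] sint_const[of 0] by simp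

lemma sint_abs_le: "f \<in> simple \<Longrightarrow> \<bar>sint f\<bar> \<le> sint (\<lambda>x. \<bar>f x\<bar>)"
  using sint_mono[of f "\<lambda>x. \<bar>f x\<bar>"] sint_mono[of "\<lambda>x. (- 1) * f x" "\<lambda>x. \<bar>f x\<bar>"] sint_cmult[of f "- 1"]
    simple_comp[of f abs] simple_comp[of f "\<lambda>u. (- 1) * u"] by force

section \<open>Outer measure and convergence in measure\<close>

lemma outer_nonneg: "E \<subseteq> \<Omega> \<Longrightarrow> 0 \<le> outer \<A> \<mu> E"
  unfolding outer_def using measure_nonneg by (intro cINF_greatest) auto

lemma outer_less_iff: "E \<subseteq> \<Omega> \<Longrightarrow> outer \<A> \<mu> E < r \<longleftrightarrow> (\<exists>A\<in>\<A>. E \<subseteq> A \<and> \<mu> A < r)"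
  unfolding outer_def
  by (subst cInf_less_iff) (auto intro!: bdd_belowI2[where m = 0] measure_nonneg)

text \<open>The Ky Fan form of nearness in measure: a single \<epsilon> bounds both the mass of the
  exceptional set and the deviation off it. The exceptional set lies in the algebra, so the outer
  measure no longer appears.\<close>

definition close :: "real \<Rightarrow> ('a \<Rightarrow> real) \<Rightarrow> ('a \<Rightarrow> real) \<Rightarrow> bool" where
  "close \<epsilon> f g \<longleftrightarrow> (\<exists>A\<in>\<A>. \<mu> A < \<epsilon> \<and> (\<forall>x\<in>\<Omega> - A. \<bar>f x - g x\<bar> \<le> \<epsilon>))"

abbreviation "converges \<equiv> conv_in_measure \<Omega> \<A> \<mu>"

lemma conv_in_measure_iff: "converges F f \<longleftrightarrow> (\<forall>\<epsilon>>0. \<forall>\<^sub>F n in sequentially. close \<epsilon> (F n) f)"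
proof -
  let ?E = "\<lambda>\<epsilon> n. {x \<in> \<Omega>. \<bar>F n x - f x\<bar> > \<epsilon>}"
  have conv: "converges F f \<longleftrightarrow>
      (\<forall>\<epsilon>>0. \<forall>r>0. \<forall>\<^sub>F n in sequentially. \<exists>A\<in>\<A>. ?E \<epsilon> n \<subseteq> A \<and> \<mu> A < r)"
    unfolding conv_in_measure_def tendsto_iff dist_real_def
    using outer_nonneg[of "?E _ _"] outer_less_iff[of "?E _ _"] by simp
  show ?thesis
  proof
    assume L: "converges F f"
    show "\<forall>\<epsilon>>0. \<forall>\<^sub>F n in sequentially. close \<epsilon> (F n) f"
    proof (intro allI impI)
      fix \<epsilon> :: real assume "\<epsilon> > 0"
      then have "\<forall>\<^sub>F n in sequentially. \<exists>A\<in>\<A>. ?E \<epsilon> n \<subseteq> A \<and> \<mu> A < \<epsilon>" using L conv by blast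
      then show "\<forall>\<^sub>F n in sequentially. close \<epsilon> (F n) f"
        by (rule eventually_mono) (force simp: close_def)
    qed
  next
    assume R: "\<forall>\<epsilon>>0. \<forall>\<^sub>F n in sequentially. close \<epsilon> (F n) f"
    show "converges F f"
      unfolding conv
    proof (intro allI impI)
      fix \<epsilon> r :: real assume "\<epsilon> > 0" "r > 0"
      \<comment> \<open>The threshold for the deviation and the one for the mass are independent
        here, so the smaller of them serves as the common one.\<close>
      then have "\<forall>\<^sub>F n in sequentially. close (min \<epsilon> r) (F n) f" using R by simp
      then show "\<forall>\<^sub>F n in sequentially. \<exists>A\<in>\<A>. ?E \<epsilon> n \<subseteq> A \<and> \<mu> A < r"
      proof (rule eventually_mono)
        fix n assume "close (min \<epsilon> r) (F n) f"
        then obtain A where A: "A \<in> \<A>" "\<mu> A < min \<epsilon> r" "\<And>x. x \<in> \<Omega> - A \<Longrightarrow> \<bar>F n x - f x\<bar> \<le> min \<epsilon> r"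
          unfolding close_def by blast
        have "?E \<epsilon> n \<subseteq> A"
        proof
          fix x assume x: "x \<in> ?E \<epsilon> n"
          show "x \<in> A" using A(3)[of x] x by (cases "x \<in> A") auto
        qed
        then show "\<exists>A\<in>\<A>. ?E \<epsilon> n \<subseteq> A \<and> \<mu> A < r" using A(1,2) by auto
      qed
    qed
  qed
qed

text \<open>Identification modulo null functions becomes convergence of a constant sequence, so the
  estimates for convergence in measure cover it too.\<close>

lemma null_eq_iff: "null_eq \<Omega> \<A> \<mu> f g \<longleftrightarrow> converges (\<lambda>_. f) g"
  unfolding null_eq_def conv_in_measure_def LIMSEQ_const_iff by (rule refl)

lemma null_eq_cong: "(\<And>x. x \<in> \<Omega> \<Longrightarrow> f x = g x) \<Longrightarrow> null_eq \<Omega> \<A> \<mu> f g"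
  by (auto simp: null_eq_iff conv_in_measure_iff close_def intro!: bexI[of _ "{}"])

text \<open>One estimate for sums, multiples, absolute values, uniqueness and null functions: off
  the union of the exceptional sets for \<open>F\<close> and \<open>G\<close> both deviations are
  small.\<close>

lemma converges_lipschitz:
  assumes F: "converges F f" and G: "converges G g" and c: "0 \<le> c"
    and le: "\<And>n x. x \<in> \<Omega> \<Longrightarrow> \<bar>H n x - h x\<bar> \<le> c * \<bar>F n x - f x\<bar> + c * \<bar>G n x - g x\<bar>"
  shows "converges H h"
  unfolding conv_in_measure_iff
proof (intro allI impI)
  fix \<epsilon> :: real assume \<epsilon>: "\<epsilon> > 0"
  \<comment> \<open>The factor 2 accounts for two deviations and two exceptional sets;
    \<open>c + 1\<close> keeps the denominator positive and covers the deviation factor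
    \<open>c\<close> as well as the factor 1 of the masses.\<close>
  define \<delta> where "\<delta> = \<epsilon> / (2 * (c + 1))"
  have \<delta>: "\<delta> > 0" "2 * c * \<delta> \<le> \<epsilon>" "2 * \<delta> \<le> \<epsilon>" using \<epsilon> c by (auto simp: \<delta>_def field_simps)
  have "\<forall>\<^sub>F n in sequentially. close \<delta> (F n) f \<and> close \<delta> (G n) g"
    using F G \<delta>(1) by (simp add: conv_in_measure_iff eventually_conj)
  then show "\<forall>\<^sub>F n in sequentially. close \<epsilon> (H n) h"
  proof (rule eventually_mono)
    fix n assume "close \<delta> (F n) f \<and> close \<delta> (G n) g"
    then obtain A B where A: "A \<in> \<A>" "\<mu> A < \<delta>" "\<And>x. x \<in> \<Omega> - A \<Longrightarrow> \<bar>F n x - f x\<bar> \<le> \<delta>"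
      and B: "B \<in> \<A>" "\<mu> B < \<delta>" "\<And>x. x \<in> \<Omega> - B \<Longrightarrow> \<bar>G n x - g x\<bar> \<le> \<delta>"
      unfolding close_def by blast
    have "\<bar>H n x - h x\<bar> \<le> \<epsilon>" if "x \<in> \<Omega> - (A \<union> B)" for x
    proof -
      have "c * \<bar>F n x - f x\<bar> \<le> c * \<delta>" "c * \<bar>G n x - g x\<bar> \<le> c * \<delta>"
        using A(3) B(3) that c by (auto intro!: mult_left_mono)
      then show ?thesis using le[of x n] that \<delta>(2) by auto
    qed
    moreover have "\<mu> (A \<union> B) < \<epsilon>" using measure_Un_le[OF A(1) B(1)] A(2) B(2) \<delta>(3) by linarith
    ultimately show "close \<epsilon> (H n) h" unfolding close_def using A(1) B(1) by (intro bexI[of _ "A \<union> B"]) auto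
  qed
qed

section \<open>Mean Cauchy sequences and determining sequences\<close>

definition mean_Cauchy :: "(nat \<Rightarrow> 'a \<Rightarrow> real) \<Rightarrow> bool" where
  "mean_Cauchy F \<longleftrightarrow> (\<forall>\<epsilon>>0. \<exists>N. \<forall>m\<ge>N. \<forall>n\<ge>N. sint (\<lambda>x. \<bar>F n x - F m x\<bar>) < \<epsilon>)"

lemma determining_iff:
  "determining \<Omega> \<A> \<mu> F f \<longleftrightarrow> (\<forall>n. F n \<in> simple) \<and> converges F f \<and> mean_Cauchy F"
  by (simp add: determining_def mean_Cauchy_def)

lemma mean_Cauchy_lipschitz:
  assumes F: "mean_Cauchy F" "\<And>n. F n \<in> simple" and G: "mean_Cauchy G" "\<And>n. G n \<in> simple"
    and H: "\<And>n. H n \<in> simple" and c: "0 \<le> c"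
    and le: "\<And>n m x. x \<in> \<Omega> \<Longrightarrow> \<bar>H n x - H m x\<bar> \<le> c * \<bar>F n x - F m x\<bar> + c * \<bar>G n x - G m x\<bar>"
  shows "mean_Cauchy H"
  unfolding mean_Cauchy_def
proof (intro allI impI)
  fix \<epsilon> :: real assume \<epsilon>: "\<epsilon> > 0"
  define \<delta> where "\<delta> = \<epsilon> / (2 * (c + 1))"
  have \<delta>: "\<delta> > 0" "2 * c * \<delta> < \<epsilon>" using \<epsilon> c by (auto simp: \<delta>_def field_simps)
  obtain N1 where N1: "\<And>m n. m \<ge> N1 \<Longrightarrow> n \<ge> N1 \<Longrightarrow> sint (\<lambda>x. \<bar>F n x - F m x\<bar>) < \<delta>"
    using F(1) \<delta>(1) unfolding mean_Cauchy_def by blast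
  obtain N2 where N2: "\<And>m n. m \<ge> N2 \<Longrightarrow> n \<ge> N2 \<Longrightarrow> sint (\<lambda>x. \<bar>G n x - G m x\<bar>) < \<delta>"
    using G(1) \<delta>(1) unfolding mean_Cauchy_def by blast
  have "sint (\<lambda>x. \<bar>H n x - H m x\<bar>) < \<epsilon>" if "m \<ge> max N1 N2" "n \<ge> max N1 N2" for m n
  proof -
    have s: "(\<lambda>x. \<bar>F n x - F m x\<bar>) \<in> simple" "(\<lambda>x. \<bar>G n x - G m x\<bar>) \<in> simple" "(\<lambda>x. \<bar>H n x - H m x\<bar>) \<in> simple"
      using F(2) G(2) H by (auto intro: simple_comp2[where \<Phi> = "\<lambda>u v. \<bar>u - v\<bar>"])
    have "sint (\<lambda>x. \<bar>H n x - H m x\<bar>) \<le> sint (\<lambda>x. c * \<bar>F n x - F m x\<bar> + c * \<bar>G n x - G m x\<bar>)"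
      using s le by (intro sint_mono simple_comp2[where \<Phi> = "\<lambda>u v. c * u + c * v"])
    also have "\<dots> = c * sint (\<lambda>x. \<bar>F n x - F m x\<bar>) + c * sint (\<lambda>x. \<bar>G n x - G m x\<bar>)"
      using s by (simp add: sint_add sint_cmult simple_comp[where \<Phi> = "\<lambda>u. c * u"])
    also have "\<dots> \<le> c * \<delta> + c * \<delta>"
      using N1[of m n] N2[of m n] that c by (intro add_mono mult_left_mono) auto
    also have "\<dots> < \<epsilon>" using \<delta>(2) by linarith
    finally show ?thesis .
  qed
  then show "\<exists>N. \<forall>m\<ge>N. \<forall>n\<ge>N. sint (\<lambda>x. \<bar>H n x - H m x\<bar>) < \<epsilon>" by blast
qed

text \<open>All lattice and vector operations on integrable functions come from this with a suitable
  Lipschitz map \<Phi>. Requiring \<open>h\<close> to be the composite only on \<Omega> lets it also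
  replace \<open>F\<close> by its absolute values when \<open>f\<close> is nonnegative.\<close>

lemma determining_lipschitz:
  assumes F: "determining \<Omega> \<A> \<mu> F f" and G: "determining \<Omega> \<A> \<mu> G g" and c: "0 \<le> c"
    and \<Phi>: "\<And>a b a' b'. \<bar>\<Phi> a b - \<Phi> a' b'\<bar> \<le> c * \<bar>a - a'\<bar> + c * \<bar>b - b'\<bar>"
    and h: "\<And>x. x \<in> \<Omega> \<Longrightarrow> h x = \<Phi> (f x) (g x)"
  shows "determining \<Omega> \<A> \<mu> (\<lambda>n x. \<Phi> (F n x) (G n x)) h"
proof -
  have "converges (\<lambda>n x. \<Phi> (F n x) (G n x)) h"
    using F G by - (rule converges_lipschitz[OF _ _ c, of F f G g], auto simp: determining_iff h \<Phi>)
  moreover have "\<And>n. (\<lambda>x. \<Phi> (F n x) (G n x)) \<in> simple"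
    using F G by (auto simp: determining_iff intro: simple_comp2)
  moreover have "mean_Cauchy (\<lambda>n x. \<Phi> (F n x) (G n x))"
    using F G by - (rule mean_Cauchy_lipschitz[OF _ _ _ _ _ c, of F G], auto simp: determining_iff \<Phi> intro: simple_comp2)
  ultimately show ?thesis by (simp add: determining_iff)
qed

lemma determining_null_eq:
  assumes "determining \<Omega> \<A> \<mu> F f" "null_eq \<Omega> \<A> \<mu> f g"
  shows "determining \<Omega> \<A> \<mu> F g"
proof -
  have "converges F g"
    using assms by - (rule converges_lipschitz[of F f "\<lambda>_. f" g 1], auto simp: determining_iff null_eq_iff)
  then show ?thesis using assms by (simp add: determining_iff)
qed

lemma determining_simple:
  assumes "f \<in> simple"
  shows "determining \<Omega> \<A> \<mu> (\<lambda>_. f) f"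
  using assms sint_const[of 0] empty_sets
  by (auto simp: determining_iff conv_in_measure_iff close_def mean_Cauchy_def intro!: bexI[of _ "{}"])

text \<open>Uniform integrability of the tail, obtained by comparison with the single bounded
  function \<open>F N\<close>: where the modulus of \<open>F n\<close> exceeds \<delta>, it is at
  most the distance to \<open>F N\<close> plus \<open>M\<close>; elsewhere it is at most \<delta>.
  The constants \<open>N\<close> and \<open>M\<close> do not depend on \<delta>, which may therefore
  be chosen after them.\<close>

lemma mean_Cauchy_uniformly_integrable:
  assumes F: "mean_Cauchy F" "\<And>n. F n \<in> simple" and \<epsilon>: "\<epsilon> > 0"
  obtains N M where "M > 0"
    "\<And>n \<delta>. n \<ge> N \<Longrightarrow> \<delta> \<ge> 0 \<Longrightarrow>
      sint (\<lambda>x. \<bar>F n x\<bar>) \<le> \<epsilon> + \<delta> * \<mu> \<Omega> + M * \<mu> {x \<in> \<Omega>. \<bar>F n x\<bar> > \<delta>}"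
proof -
  obtain N where N: "\<And>m n. m \<ge> N \<Longrightarrow> n \<ge> N \<Longrightarrow> sint (\<lambda>x. \<bar>F n x - F m x\<bar>) < \<epsilon>"
    using F(1) \<epsilon> unfolding mean_Cauchy_def by blast
  obtain M where M: "M > 0" "\<And>x. x \<in> \<Omega> \<Longrightarrow> \<bar>F N x\<bar> \<le> M" using simple_bounded[OF F(2)] by blast
  have "sint (\<lambda>x. \<bar>F n x\<bar>) \<le> \<epsilon> + \<delta> * \<mu> \<Omega> + M * \<mu> {x \<in> \<Omega>. \<bar>F n x\<bar> > \<delta>}" if n: "n \<ge> N" and \<delta>: "\<delta> \<ge> 0" for n \<delta>
  proof -
    let ?E = "{x \<in> \<Omega>. \<bar>F n x\<bar> > \<delta>}" and ?d = "\<lambda>x. \<bar>F n x - F N x\<bar>"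
    have E: "?E \<in> \<A>" using F(2) by (rule simple_level_set)
    have d: "?d \<in> simple" using simple_comp2[OF F(2) F(2), of "\<lambda>u v. \<bar>u - v\<bar>"] .
    have mi: "(\<lambda>x. M * indicator ?E x) \<in> simple" using simple_comp[OF simple_indicator[OF E]] .
    have dd: "(\<lambda>x. ?d x + \<delta>) \<in> simple" using simple_comp[OF d, of "\<lambda>u. u + \<delta>"] .
    have "sint (\<lambda>x. \<bar>F n x\<bar>) \<le> sint (\<lambda>x. (?d x + \<delta>) + M * indicator ?E x)"
    proof (rule sint_mono)
      show "(\<lambda>x. \<bar>F n x\<bar>) \<in> simple" using simple_comp[OF F(2)] .
      show "(\<lambda>x. (?d x + \<delta>) + M * indicator ?E x) \<in> simple"
        using simple_comp2[OF dd mi, of "(+)"] .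
      fix x assume x: "x \<in> \<Omega>"
      then show "\<bar>F n x\<bar> \<le> (?d x + \<delta>) + M * indicator ?E x"
        using M(2)[OF x] \<delta> by (cases "\<bar>F n x\<bar> > \<delta>") (auto simp: indicator_def)
    qed
    also have "\<dots> = sint ?d + \<delta> * \<mu> \<Omega> + M * \<mu> ?E"
      using sint_add[OF dd mi] sint_add[OF d simple_const[of \<delta>]] sint_const[of \<delta>]
        sint_cmult[OF simple_indicator[OF E], of M] sint_indicator[OF E] by simp
    finally show ?thesis using N[of N n] n by simp
  qed
  then show thesis using that M(1) by blast
qed

text \<open>The core of well-definedness: convergence in measure makes the set where
  \<open>F n\<close> is large have small mass, and uniform integrability makes the integral over it
  small.\<close>

lemma determining_zero:
  assumes F: "determining \<Omega> \<A> \<mu> F f" and f: "\<And>x. x \<in> \<Omega> \<Longrightarrow> f x = 0"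
  shows "(\<lambda>n. sint (\<lambda>x. \<bar>F n x\<bar>)) \<longlonglongrightarrow> 0"
proof (rule tendstoI)
  fix e :: real assume e: "e > 0"
  have simple: "\<And>n. F n \<in> simple" and Cauchy: "mean_Cauchy F" and conv: "converges F f"
    using F by (auto simp: determining_iff)
  obtain N M where M: "M > 0" and N: "\<And>n \<delta>. n \<ge> N \<Longrightarrow> \<delta> \<ge> 0 \<Longrightarrow>
      sint (\<lambda>x. \<bar>F n x\<bar>) \<le> e / 4 + \<delta> * \<mu> \<Omega> + M * \<mu> {x \<in> \<Omega>. \<bar>F n x\<bar> > \<delta>}"
    by (rule mean_Cauchy_uniformly_integrable[OF Cauchy simple, of "e / 4"]) (use e in auto)
  have \<Omega>: "0 \<le> \<mu> \<Omega>" by (rule measure_nonneg[OF top])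
  \<comment> \<open>Here \<delta> is both the level and the bound on the mass of the exceptional
    set, so the two terms add up to \<open>\<delta> * (\<mu> \<Omega> + M) = e / 4\<close>; with the
    \<open>e / 4\<close> above, the total stays below \<open>e\<close>.\<close>
  define \<delta> where "\<delta> = e / 4 / (\<mu> \<Omega> + M)"
  have "\<delta> > 0" using e M \<Omega> by (simp add: \<delta>_def)
  moreover have "\<delta> * (\<mu> \<Omega> + M) = e / 4"
    unfolding \<delta>_def using M \<Omega> by (intro nonzero_eq_divide_eq[THEN iffD1]) auto
  then have "\<delta> * \<mu> \<Omega> + \<delta> * M = e / 4" by (simp add: algebra_simps)
  ultimately have \<delta>: "\<delta> > 0" "\<delta> * \<mu> \<Omega> + M * \<delta> \<le> e / 4" by (auto simp: mult.commute)
  have "\<forall>\<^sub>F n in sequentially. close \<delta> (F n) f" using conv \<delta>(1) by (simp add: conv_in_measure_iff)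
  then show "\<forall>\<^sub>F n in sequentially. dist (sint (\<lambda>x. \<bar>F n x\<bar>)) 0 < e"
    using eventually_ge_at_top[of N]
  proof eventually_elim
    case (elim n)
    then obtain A where A: "A \<in> \<A>" "\<mu> A < \<delta>" "\<And>x. x \<in> \<Omega> - A \<Longrightarrow> \<bar>F n x - f x\<bar> \<le> \<delta>"
      unfolding close_def by blast
    have "{x \<in> \<Omega>. \<bar>F n x\<bar> > \<delta>} \<subseteq> A" using A(3) f by force
    then have "\<mu> {x \<in> \<Omega>. \<bar>F n x\<bar> > \<delta>} < \<delta>"
      using measure_mono[OF simple_level_set[OF simple] A(1)] A(2) by (meson order_le_less_trans)
    then have "M * \<mu> {x \<in> \<Omega>. \<bar>F n x\<bar> > \<delta>} \<le> M * \<delta>" using M by (intro mult_left_mono) auto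
    then have "sint (\<lambda>x. \<bar>F n x\<bar>) < e" using N[OF elim(2), of \<delta>] \<delta> e by linarith
    moreover have "0 \<le> sint (\<lambda>x. \<bar>F n x\<bar>)" by (intro sint_nonneg simple_comp[OF simple]) auto
    ultimately show ?case by simp
  qed
qed

section \<open>The integral as a limit\<close>

abbreviation "integral\<^sub>f \<equiv> fa_integral \<Omega> \<A> \<mu>"
abbreviation "integrable\<^sub>f \<equiv> L1 \<Omega> \<A> \<mu>"

text \<open>The difference of the two sequences determines the zero function.\<close>

lemma determining_unique:
  assumes F: "determining \<Omega> \<A> \<mu> F f" and G: "determining \<Omega> \<A> \<mu> G f"
  shows "(\<lambda>n. sint (F n) - sint (G n)) \<longlonglongrightarrow> 0"
proof -
  have s: "F n \<in> simple" "G n \<in> simple" for n using F G by (auto simp: determining_iff)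
  have "determining \<Omega> \<A> \<mu> (\<lambda>n x. F n x - G n x) (\<lambda>_. 0)"
    by (rule determining_lipschitz[OF F G, of 1]) auto
  then have "(\<lambda>n. sint (\<lambda>x. \<bar>F n x - G n x\<bar>)) \<longlonglongrightarrow> 0" by (rule determining_zero) simp
  moreover have "\<bar>sint (F n) - sint (G n)\<bar> \<le> sint (\<lambda>x. \<bar>F n x - G n x\<bar>)" for n
    using sint_abs_le[OF simple_comp2[OF s(1)[of n] s(2)[of n], of "(-)"]] sint_diff[OF s(1)[of n] s(2)[of n]] by simp
  ultimately show ?thesis
    by - (rule Lim_null_comparison[where g = "\<lambda>n. sint (\<lambda>x. \<bar>F n x - G n x\<bar>)"], auto)
qed

text \<open>Justifies the definite description: completeness of the reals gives existence, the
  previous lemma uniqueness. The properties of the integral below are limits of those for simple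
  functions.\<close>

lemma fa_integral_LIMSEQ:
  assumes F: "determining \<Omega> \<A> \<mu> F f"
  shows "(\<lambda>n. sint (F n)) \<longlonglongrightarrow> integral\<^sub>f f"
proof -
  have s: "\<And>n. F n \<in> simple" using F by (auto simp: determining_iff)
  have "Cauchy (\<lambda>n. sint (F n))"
    unfolding Cauchy_iff
  proof (intro allI impI)
    fix e :: real assume "e > 0"
    then obtain N where N: "\<And>m n. m \<ge> N \<Longrightarrow> n \<ge> N \<Longrightarrow> sint (\<lambda>x. \<bar>F n x - F m x\<bar>) < e"
      using F unfolding determining_iff mean_Cauchy_def by blast
    have "norm (sint (F m) - sint (F n)) \<le> sint (\<lambda>x. \<bar>F m x - F n x\<bar>)" for m n
      using sint_abs_le[OF simple_comp2[OF s s, of "(-)"]] sint_diff[OF s s] by simp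
    then show "\<exists>M. \<forall>m\<ge>M. \<forall>n\<ge>M. norm (sint (F m) - sint (F n)) < e" using N by (meson order_le_less_trans)
  qed
  then obtain I where I: "(\<lambda>n. sint (F n)) \<longlonglongrightarrow> I" by (auto simp: Cauchy_convergent_iff convergent_def)
  have "integral\<^sub>f f = I"
    unfolding fa_integral_def
  proof (rule the_equality)
    show "\<exists>F. determining \<Omega> \<A> \<mu> F f \<and> (\<lambda>n. sint (F n)) \<longlonglongrightarrow> I" using F I by blast
    fix J assume "\<exists>F. determining \<Omega> \<A> \<mu> F f \<and> (\<lambda>n. sint (F n)) \<longlonglongrightarrow> J"
    then obtain G where G: "determining \<Omega> \<A> \<mu> G f" "(\<lambda>n. sint (G n)) \<longlonglongrightarrow> J" by blast
    have "I - J = 0"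
      by (rule LIMSEQ_unique[OF tendsto_diff[OF I G(2)] determining_unique[OF F G(1)]])
    then show "J = I" by simp
  qed
  then show ?thesis using I by simp
qed

lemma fa_integral_simple: "f \<in> simple \<Longrightarrow> integral\<^sub>f f = sint f"
  using fa_integral_LIMSEQ[OF determining_simple] LIMSEQ_unique tendsto_const by blast

lemma L1_simple: "f \<in> simple \<Longrightarrow> f \<in> integrable\<^sub>f"
  using determining_simple by (auto simp: L1_def)

lemma L1_lipschitz:
  assumes "f \<in> integrable\<^sub>f" "g \<in> integrable\<^sub>f" "0 \<le> c"
    and "\<And>a b a' b'. \<bar>\<Phi> a b - \<Phi> a' b'\<bar> \<le> c * \<bar>a - a'\<bar> + c * \<bar>b - b'\<bar>"
  shows "(\<lambda>x. \<Phi> (f x) (g x)) \<in> integrable\<^sub>f"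
proof -
  obtain F G where F: "determining \<Omega> \<A> \<mu> F f" and G: "determining \<Omega> \<A> \<mu> G g"
    using assms by (auto simp: L1_def)
  have "determining \<Omega> \<A> \<mu> (\<lambda>n x. \<Phi> (F n x) (G n x)) (\<lambda>x. \<Phi> (f x) (g x))"
    by (rule determining_lipschitz[OF F G assms(3,4)]) auto
  then show ?thesis by (auto simp: L1_def)
qed

lemma L1_add: "f \<in> integrable\<^sub>f \<Longrightarrow> g \<in> integrable\<^sub>f \<Longrightarrow> (\<lambda>x. f x + g x) \<in> integrable\<^sub>f"
  by (rule L1_lipschitz[of _ _ 1]) auto

lemma L1_diff: "f \<in> integrable\<^sub>f \<Longrightarrow> g \<in> integrable\<^sub>f \<Longrightarrow> (\<lambda>x. f x - g x) \<in> integrable\<^sub>f"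
  by (rule L1_lipschitz[of _ _ 1]) auto

lemma L1_abs: "f \<in> integrable\<^sub>f \<Longrightarrow> (\<lambda>x. \<bar>f x\<bar>) \<in> integrable\<^sub>f"
  by (rule L1_lipschitz[of f f 1]) auto

lemma L1_cmult: "f \<in> integrable\<^sub>f \<Longrightarrow> (\<lambda>x. k * f x) \<in> integrable\<^sub>f"
  by (rule L1_lipschitz[of f f "\<bar>k\<bar>"]) (auto simp: abs_mult_diff)

lemma fa_integral_add:
  assumes "f \<in> integrable\<^sub>f" "g \<in> integrable\<^sub>f"
  shows "integral\<^sub>f (\<lambda>x. f x + g x) = integral\<^sub>f f + integral\<^sub>f g"
proof -
  obtain F G where F: "determining \<Omega> \<A> \<mu> F f" and G: "determining \<Omega> \<A> \<mu> G g"
    using assms by (auto simp: L1_def)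
  have "determining \<Omega> \<A> \<mu> (\<lambda>n x. F n x + G n x) (\<lambda>x. f x + g x)"
    by (rule determining_lipschitz[OF F G, of 1]) auto
  then have "(\<lambda>n. sint (\<lambda>x. F n x + G n x)) \<longlonglongrightarrow> integral\<^sub>f (\<lambda>x. f x + g x)"
    by (rule fa_integral_LIMSEQ)
  moreover have "sint (\<lambda>x. F n x + G n x) = sint (F n) + sint (G n)" for n
    using F G by (intro sint_add) (auto simp: determining_iff)
  ultimately show ?thesis
    using tendsto_add[OF fa_integral_LIMSEQ[OF F] fa_integral_LIMSEQ[OF G]] LIMSEQ_unique by simp
qed

lemma fa_integral_cmult:
  assumes "f \<in> integrable\<^sub>f"
  shows "integral\<^sub>f (\<lambda>x. k * f x) = k * integral\<^sub>f f"
proof -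
  obtain F where F: "determining \<Omega> \<A> \<mu> F f"
    using assms by (auto simp: L1_def)
  have "determining \<Omega> \<A> \<mu> (\<lambda>n x. k * F n x) (\<lambda>x. k * f x)"
    by (rule determining_lipschitz[OF F F, of "\<bar>k\<bar>"]) (auto simp: abs_mult_diff)
  then have "(\<lambda>n. sint (\<lambda>x. k * F n x)) \<longlonglongrightarrow> integral\<^sub>f (\<lambda>x. k * f x)"
    by (rule fa_integral_LIMSEQ)
  moreover have "sint (\<lambda>x. k * F n x) = k * sint (F n)" for n
    using F by (intro sint_cmult) (auto simp: determining_iff)
  ultimately show ?thesis
    using tendsto_mult_left[OF fa_integral_LIMSEQ[OF F], of k] LIMSEQ_unique by simp
qed

lemma fa_integral_diff:
  assumes "f \<in> integrable\<^sub>f" "g \<in> integrable\<^sub>f"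
  shows "integral\<^sub>f (\<lambda>x. f x - g x) = integral\<^sub>f f - integral\<^sub>f g"
  using fa_integral_add[OF assms(1) L1_cmult[OF assms(2), of "- 1"]] fa_integral_cmult[OF assms(2), of "- 1"]
  by simp

lemma fa_integral_nonneg:
  assumes f: "f \<in> integrable\<^sub>f" "\<And>x. x \<in> \<Omega> \<Longrightarrow> 0 \<le> f x"
  shows "0 \<le> integral\<^sub>f f"
proof -
  obtain F where F: "determining \<Omega> \<A> \<mu> F f" using f by (auto simp: L1_def)
  \<comment> \<open>Since \<open>f\<close> equals its modulus on \<Omega>, the approximants can be
    made nonnegative.\<close>
  have "determining \<Omega> \<A> \<mu> (\<lambda>n x. \<bar>F n x\<bar>) f"
    using f(2) by - (rule determining_lipschitz[OF F F, of 1], auto)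
  then have "(\<lambda>n. sint (\<lambda>x. \<bar>F n x\<bar>)) \<longlonglongrightarrow> integral\<^sub>f f" by (rule fa_integral_LIMSEQ)
  moreover have "0 \<le> sint (\<lambda>x. \<bar>F n x\<bar>)" for n
    using F simple_comp[of "F n" abs] by (intro sint_nonneg) (auto simp: determining_iff)
  ultimately show ?thesis by (intro LIMSEQ_le_const) auto
qed

lemma fa_integral_mono:
  assumes "f \<in> integrable\<^sub>f" "g \<in> integrable\<^sub>f" "\<And>x. x \<in> \<Omega> \<Longrightarrow> f x \<le> g x"
  shows "integral\<^sub>f f \<le> integral\<^sub>f g"
  using fa_integral_nonneg[OF L1_diff[OF assms(2,1)]] fa_integral_diff[OF assms(2,1)] assms(3) by simp

text \<open>A sequence determining \<open>f\<close> also determines \<open>g\<close>, so both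
  integrals are the same limit.\<close>

lemma fa_integral_null_eq:
  assumes "f \<in> integrable\<^sub>f" "null_eq \<Omega> \<A> \<mu> f g"
  shows "g \<in> integrable\<^sub>f" "integral\<^sub>f g = integral\<^sub>f f"
proof -
  obtain F where F: "determining \<Omega> \<A> \<mu> F f" using assms by (auto simp: L1_def)
  have G: "determining \<Omega> \<A> \<mu> F g" by (rule determining_null_eq[OF F assms(2)])
  then show "g \<in> integrable\<^sub>f" by (auto simp: L1_def)
  show "integral\<^sub>f g = integral\<^sub>f f"
    by (rule LIMSEQ_unique[OF fa_integral_LIMSEQ[OF G] fa_integral_LIMSEQ[OF F]])
qed

section \<open>The seminorm of \<open>L1\<close> and density of the simple functions\<close>

abbreviation "norm\<^sub>1 \<equiv> L1_norm \<Omega> \<A> \<mu>"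

lemma L1_norm_nonneg: "f \<in> integrable\<^sub>f \<Longrightarrow> 0 \<le> norm\<^sub>1 f"
  unfolding L1_norm_def by (intro fa_integral_nonneg L1_abs) auto

lemma L1_norm_triangle:
  assumes "f \<in> integrable\<^sub>f" "g \<in> integrable\<^sub>f"
  shows "norm\<^sub>1 (\<lambda>x. f x + g x) \<le> norm\<^sub>1 f + norm\<^sub>1 g"
  using assms unfolding L1_norm_def
  by (subst fa_integral_add[symmetric]) (auto intro!: fa_integral_mono L1_abs L1_add)

lemma L1_norm_cmult: "f \<in> integrable\<^sub>f \<Longrightarrow> norm\<^sub>1 (\<lambda>x. k * f x) = \<bar>k\<bar> * norm\<^sub>1 f"
  unfolding L1_norm_def abs_mult by (intro fa_integral_cmult L1_abs)

lemma abs_fa_integral_le: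
  assumes f: "f \<in> integrable\<^sub>f"
  shows "\<bar>integral\<^sub>f f\<bar> \<le> norm\<^sub>1 f"
proof -
  have "integral\<^sub>f f \<le> norm\<^sub>1 f" "integral\<^sub>f (\<lambda>x. (- 1) * f x) \<le> norm\<^sub>1 f"
    unfolding L1_norm_def using L1_abs[OF f] L1_cmult[OF f, of "- 1"] f
    by (auto intro!: fa_integral_mono)
  then show ?thesis using fa_integral_cmult[OF f, of "- 1"] by simp
qed

lemma L1_norm_null_eq:
  assumes "f \<in> integrable\<^sub>f" "g \<in> integrable\<^sub>f" "null_eq \<Omega> \<A> \<mu> f g"
  shows "norm\<^sub>1 (\<lambda>x. f x - g x) = 0"
proof -
  have "converges (\<lambda>_ _. 0) (\<lambda>x. \<bar>f x - g x\<bar>)"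
    using assms(3) unfolding null_eq_iff
    by - (rule converges_lipschitz[of "\<lambda>_. f" g "\<lambda>_. f" g 1], auto)
  then have "null_eq \<Omega> \<A> \<mu> (\<lambda>_. 0) (\<lambda>x. \<bar>f x - g x\<bar>)" unfolding null_eq_iff .
  then have "integral\<^sub>f (\<lambda>x. \<bar>f x - g x\<bar>) = integral\<^sub>f (\<lambda>_. 0)"
    by (rule fa_integral_null_eq(2)[OF L1_simple[OF simple_const]])
  then show ?thesis by (simp add: L1_norm_def fa_integral_simple[OF simple_const] sint_const)
qed

text \<open>For fixed \<open>n\<close> the seminorm of \<open>f - F n\<close> is the limit over
  \<open>m\<close> of the mean distances between \<open>F m\<close> and \<open>F n\<close>, which
  the Cauchy condition makes small.\<close>

lemma determining_norm_LIMSEQ: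
  assumes F: "determining \<Omega> \<A> \<mu> F f"
  shows "(\<lambda>n. norm\<^sub>1 (\<lambda>x. f x - F n x)) \<longlonglongrightarrow> 0"
proof (rule tendstoI)
  fix e :: real assume e: "e > 0"
  have s: "\<And>n. F n \<in> simple" using F by (simp add: determining_iff)
  obtain N where N: "\<And>m n. m \<ge> N \<Longrightarrow> n \<ge> N \<Longrightarrow> sint (\<lambda>x. \<bar>F n x - F m x\<bar>) < e / 2"
    using F e unfolding determining_iff mean_Cauchy_def by (meson half_gt_zero)
  have "dist (norm\<^sub>1 (\<lambda>x. f x - F n x)) 0 < e" if n: "n \<ge> N" for n
  proof -
    have "determining \<Omega> \<A> \<mu> (\<lambda>m x. \<bar>F m x - F n x\<bar>) (\<lambda>x. \<bar>f x - F n x\<bar>)"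
      by (rule determining_lipschitz[OF F determining_simple[OF s], of 1]) auto
    then have "(\<lambda>m. sint (\<lambda>x. \<bar>F m x - F n x\<bar>)) \<longlonglongrightarrow> norm\<^sub>1 (\<lambda>x. f x - F n x)"
      unfolding L1_norm_def by (rule fa_integral_LIMSEQ)
    then have "norm\<^sub>1 (\<lambda>x. f x - F n x) \<le> e / 2"
      using N n by (intro LIMSEQ_le_const2) (auto intro!: exI[of _ N] less_imp_le)
    moreover have "f \<in> integrable\<^sub>f" using F by (auto simp: L1_def)
    ultimately show ?thesis using e L1_norm_nonneg[OF L1_diff[OF _ L1_simple[OF s]], of f n] by simp
  qed
  then show "\<forall>\<^sub>F n in sequentially. dist (norm\<^sub>1 (\<lambda>x. f x - F n x)) 0 < e"
    by (auto simp: eventually_sequentially)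
qed

section \<open>Domination and countable subfamilies of set functions\<close>

lemma finitely_additive_iff: "finitely_additive \<Omega> \<A> \<nu> \<longleftrightarrow> \<nu> \<in> ba_pos \<A>"
  by (simp add: finitely_additive_def finitely_additive_axioms_def algebra_axioms)

lemma L1_cong:
  assumes "f \<in> integrable\<^sub>f" "\<And>x. x \<in> \<Omega> \<Longrightarrow> f x = g x"
  shows "g \<in> integrable\<^sub>f"
  by (rule fa_integral_null_eq(1)[OF assms(1) null_eq_cong[OF assms(2)]])

lemma simple_fun_pos_iff: "s \<in> simple_fun_pos \<Omega> \<A> \<longleftrightarrow> s \<in> simple \<and> (\<forall>x\<in>\<Omega>. 0 \<le> s x)"
  by (simp add: simple_fun_pos_def)

lemma
  assumes \<nu>: "\<nu> \<in> ba_pos \<A>" and c: "c > 0" and dom: "\<And>A. A \<in> \<A> \<Longrightarrow> \<nu> A \<le> c * \<mu> A"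
    and F: "determining \<Omega> \<A> \<mu> F f"
  shows determining_dominated: "determining \<Omega> \<A> \<nu> F f"
    and L1_norm_dominated: "L1_norm \<Omega> \<A> \<nu> f \<le> c * norm\<^sub>1 f"
proof -
  interpret \<nu>: finitely_additive \<Omega> \<A> \<nu> using \<nu> by (simp add: finitely_additive_iff)
  have s: "\<And>n. F n \<in> simple" using F by (simp add: determining_iff)
  have sint_le: "\<nu>.sint g \<le> c * sint g" if g: "g \<in> simple" "\<And>x. x \<in> \<Omega> \<Longrightarrow> 0 \<le> g x" for g
  proof -
    have "g ` \<Omega> \<subseteq> {0..}" using g(2) by auto
    moreover have "{x \<in> \<Omega>. g x = y} \<in> \<A>" for y using simple_level_set[OF g(1)] .
    ultimately have "\<nu>.sint g \<le> (\<Sum>y\<in>g ` \<Omega>. y * (c * \<mu> {x \<in> \<Omega>. g x = y}))"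
      unfolding simple_fun_integral_def by (intro sum_mono mult_left_mono dom) auto
    then show ?thesis by (simp add: simple_fun_integral_def sum_distrib_left mult.left_commute)
  qed
  have "\<nu>.converges F f"
    unfolding \<nu>.conv_in_measure_iff
  proof (intro allI impI)
    fix \<epsilon> :: real assume \<epsilon>: "\<epsilon> > 0"
    \<comment> \<open>A set of \<mu>-mass below \<delta> has \<nu>-mass below
      \<open>c * \<delta>\<close>, so both \<delta> and \<open>c * \<delta>\<close> must stay within
      \<epsilon>.\<close>
    define \<delta> where "\<delta> = min \<epsilon> (\<epsilon> / c)"
    have \<delta>: "\<delta> > 0" "\<delta> \<le> \<epsilon>" "c * \<delta> \<le> \<epsilon>" using \<epsilon> c by (auto simp: \<delta>_def min_def field_simps)
    have "\<forall>\<^sub>F n in sequentially. close \<delta> (F n) f" using F \<delta>(1) by (simp add: determining_iff conv_in_measure_iff)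
    then show "\<forall>\<^sub>F n in sequentially. \<nu>.close \<epsilon> (F n) f"
    proof (rule eventually_mono)
      fix n assume "close \<delta> (F n) f"
      then obtain A where A: "A \<in> \<A>" "\<mu> A < \<delta>" "\<And>x. x \<in> \<Omega> - A \<Longrightarrow> \<bar>F n x - f x\<bar> \<le> \<delta>"
        unfolding close_def by blast
      have "\<nu> A \<le> c * \<mu> A" by (rule dom[OF A(1)])
      also have "\<dots> < c * \<delta>" using A(2) c by simp
      finally have "\<nu> A < \<epsilon>" using \<delta>(3) by simp
      moreover have "\<forall>x\<in>\<Omega> - A. \<bar>F n x - f x\<bar> \<le> \<epsilon>" using A(3) \<delta>(2) by (meson order_trans)
      ultimately show "\<nu>.close \<epsilon> (F n) f" using A(1) unfolding \<nu>.close_def by blast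
    qed
  qed
  moreover have "\<nu>.mean_Cauchy F"
    unfolding \<nu>.mean_Cauchy_def
  proof (intro allI impI)
    fix \<epsilon> :: real assume \<epsilon>: "\<epsilon> > 0"
    obtain N where N: "\<And>m n. m \<ge> N \<Longrightarrow> n \<ge> N \<Longrightarrow> sint (\<lambda>x. \<bar>F n x - F m x\<bar>) < \<epsilon> / c"
      using F \<epsilon> c unfolding determining_iff mean_Cauchy_def by (meson divide_pos_pos)
    have "\<nu>.sint (\<lambda>x. \<bar>F n x - F m x\<bar>) < \<epsilon>" if mn: "m \<ge> N" "n \<ge> N" for m n
    proof -
      have "\<nu>.sint (\<lambda>x. \<bar>F n x - F m x\<bar>) \<le> c * sint (\<lambda>x. \<bar>F n x - F m x\<bar>)"
        using simple_comp2[OF s s, of "\<lambda>u v. \<bar>u - v\<bar>"] by (intro sint_le) auto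
      also have "\<dots> < \<epsilon>" using N[OF mn] c by (simp add: field_simps)
      finally show ?thesis .
    qed
    then show "\<exists>N. \<forall>m\<ge>N. \<forall>n\<ge>N. \<nu>.sint (\<lambda>x. \<bar>F n x - F m x\<bar>) < \<epsilon>" by blast
  qed
  ultimately show det: "determining \<Omega> \<A> \<nu> F f" using s by (simp add: \<nu>.determining_iff)
  have "determining \<Omega> \<A> \<mu> (\<lambda>n x. \<bar>F n x\<bar>) (\<lambda>x. \<bar>f x\<bar>)"
    by (rule determining_lipschitz[OF F F, of 1]) auto
  then have lim: "(\<lambda>n. sint (\<lambda>x. \<bar>F n x\<bar>)) \<longlonglongrightarrow> norm\<^sub>1 f"
    unfolding L1_norm_def by (rule fa_integral_LIMSEQ)
  have "determining \<Omega> \<A> \<nu> (\<lambda>n x. \<bar>F n x\<bar>) (\<lambda>x. \<bar>f x\<bar>)"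
    by (rule \<nu>.determining_lipschitz[OF det det, of 1]) auto
  then have "(\<lambda>n. \<nu>.sint (\<lambda>x. \<bar>F n x\<bar>)) \<longlonglongrightarrow> \<nu>.norm\<^sub>1 f"
    unfolding L1_norm_def by (rule \<nu>.fa_integral_LIMSEQ)
  moreover have "\<nu>.sint (\<lambda>x. \<bar>F n x\<bar>) \<le> c * sint (\<lambda>x. \<bar>F n x\<bar>)" for n
    using simple_comp[OF s, of abs] by (intro sint_le) auto
  ultimately show "\<nu>.norm\<^sub>1 f \<le> c * norm\<^sub>1 f"
    using tendsto_mult_left[OF lim, of c] by (intro LIMSEQ_le) auto
qed

text \<open>The analogue of the Halmos-Savage theorem. Countable additivity is replaced by maximality of
  \<open>J \<nu> = inf {\<nu> B + \<mu> (\<Omega> - B) | B \<in> \<A>}\<close>, the total mass of the infimum of \<open>\<nu>\<close> and \<open>\<mu>\<close> in \<open>ba\<close>: adding to \<open>\<nu>\<close>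
  a set function that charges a \<open>\<nu>\<close>-null set \<open>A\<close> increases \<open>J\<close> by an amount depending on \<open>A\<close> only.\<close>

lemma countable_charging_subfamily:
  fixes M :: "('a set \<Rightarrow> real) set"
  assumes ne: "M \<noteq> {}" and M: "M \<subseteq> ba_pos \<A>"
    and add: "\<And>\<nu> \<nu>'. \<nu> \<in> M \<Longrightarrow> \<nu>' \<in> M \<Longrightarrow> (\<lambda>A. \<nu> A + \<nu>' A) \<in> M"
    and dom: "\<And>\<nu>. \<nu> \<in> M \<Longrightarrow> \<exists>c. \<forall>A\<in>\<A>. \<nu> A \<le> c * \<mu> A"
    and charge: "\<And>A. A \<in> \<A> \<Longrightarrow> \<mu> A > 0 \<Longrightarrow> \<exists>\<nu>\<in>M. \<nu> A > 0"
  obtains \<nu> :: "nat \<Rightarrow> 'a set \<Rightarrow> real"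
  where "\<And>n. \<nu> n \<in> M" "\<And>A. A \<in> \<A> \<Longrightarrow> \<mu> A > 0 \<Longrightarrow> \<exists>n. \<nu> n A > 0"
proof -
  define J where "J \<nu> = (INF B\<in>\<A>. \<nu> B + \<mu> (\<Omega> - B))" for \<nu>
  have fa: "finitely_additive \<Omega> \<A> \<nu>" if "\<nu> \<in> M" for \<nu> using M that by (auto simp: finitely_additive_iff)
  have Jle: "J \<nu> \<le> \<nu> B + \<mu> (\<Omega> - B)" if "\<nu> \<in> M" "B \<in> \<A>" for \<nu> B
    unfolding J_def
  proof (rule cINF_lower[OF bdd_belowI2[where m = 0]])
    show "0 \<le> \<nu> B + \<mu> (\<Omega> - B)" if "B \<in> \<A>" for B
      using finitely_additive.measure_nonneg[OF fa[OF \<open>\<nu> \<in> M\<close>] that] measure_nonneg[OF compl_sets[OF that]] by simp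
  qed (rule that)
  have Jgr: "m \<le> J \<nu>" if "\<And>B. B \<in> \<A> \<Longrightarrow> m \<le> \<nu> B + \<mu> (\<Omega> - B)" for m \<nu>
    unfolding J_def using that by (intro cINF_greatest) auto
  have "J \<nu> \<le> \<mu> \<Omega>" if "\<nu> \<in> M" for \<nu>
    using Jle[OF that empty_sets] finitely_additive.measure_empty[OF fa[OF that]] by simp
  then have bdd: "bdd_above (J ` M)" by (intro bdd_aboveI2) auto
  define s where "s = (SUP \<nu>\<in>M. J \<nu>)"
  \<comment> \<open>A maximising sequence suffices; the supremum need not be attained in
    \<open>M\<close>.\<close>
  have "\<exists>\<nu>\<in>M. s - 1 / real (Suc n) < J \<nu>" for n
    using less_cSUP_iff[OF ne bdd, of "s - 1 / real (Suc n)"] by (simp add: s_def)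
  then obtain \<nu> where \<nu>: "\<And>n. \<nu> n \<in> M" "\<And>n. s - 1 / real (Suc n) < J (\<nu> n)" by metis
  have "\<exists>n. \<nu> n A > 0" if A: "A \<in> \<A>" "\<mu> A > 0" for A
  proof (rule ccontr)
    assume "\<not> (\<exists>n. \<nu> n A > 0)"
    then have null: "\<nu> n A = 0" for n
      using finitely_additive.measure_nonneg[OF fa[OF \<nu>(1)[of n]] A(1)] by (metis order_le_less)
    obtain \<rho> where \<rho>: "\<rho> \<in> M" "\<rho> A > 0" using charge[OF A] by blast
    interpret \<rho>: finitely_additive \<Omega> \<A> \<rho> by (rule fa[OF \<rho>(1)])
    obtain c0 where c0: "\<And>B. B \<in> \<A> \<Longrightarrow> \<rho> B \<le> c0 * \<mu> B" using dom[OF \<rho>(1)] by blast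
    \<comment> \<open>Having \<open>c \<ge> 1\<close> allows \<open>\<rho> B\<close> to be enlarged
      to \<open>c * \<rho> B\<close> in the estimate below.\<close>
    define c where "c = max 1 c0"
    have c: "c \<ge> 1" by (simp add: c_def)
    have \<rho>le: "\<rho> B \<le> c * \<mu> B" if "B \<in> \<A>" for B
      using c0[OF that] mult_right_mono[OF _ measure_nonneg[OF that], of c0 c] by (simp add: c_def)
    obtain n where n: "1 / real (Suc n) < \<rho> A / c"
      using nat_approx_posE[of "\<rho> A / c"] \<rho>(2) c by (metis divide_pos_pos less_le_trans zero_less_one)
    interpret \<nu>: finitely_additive \<Omega> \<A> "\<nu> n" by (rule fa[OF \<nu>(1)])
    \<comment> \<open>\<open>J (\<nu> n)\<close> is tested at \<open>A \<union> B\<close> instead of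
      \<open>B\<close>. This does not increase the \<nu>-term, as \<open>A\<close> is null, and
      frees the mass \<open>\<mu> (A - B)\<close>. Domination of \<rho> shows that this mass and
      \<open>\<rho> B\<close> together outweigh \<open>\<rho> A / c\<close>, a gain larger than the
      defect of \<open>\<nu> n\<close>.\<close>
    have "J (\<nu> n) + \<rho> A / c \<le> J (\<lambda>A. \<nu> n A + \<rho> A)"
    proof (rule Jgr)
      fix B assume B: "B \<in> \<A>"
      have sets: "A \<union> B \<in> \<A>" "A - B \<in> \<A>" "A \<inter> B \<in> \<A>" "\<Omega> - B \<in> \<A>" using A B by auto
      have "\<nu> n (A \<union> B) \<le> \<nu> n B" using \<nu>.measure_Un_le[OF A(1) B] null by simp
      moreover have "\<mu> (\<Omega> - B) = \<mu> (A - B) + \<mu> (\<Omega> - (A \<union> B))"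
      proof -
        have "(\<Omega> - B) \<inter> A = A - B" "(\<Omega> - B) - A = \<Omega> - (A \<union> B)" using sets_into_space[OF A(1)] by auto
        then show ?thesis using measure_split[OF sets(4) A(1)] by simp
      qed
      moreover have "\<rho> A / c \<le> \<rho> B + \<mu> (A - B)"
      proof -
        have "\<rho> A \<le> \<rho> B + c * \<mu> (A - B)"
          using \<rho>.measure_split[OF A(1) B] \<rho>.measure_mono[OF sets(3) B] \<rho>le[OF sets(2)] by auto
        also have "\<dots> \<le> c * (\<rho> B + \<mu> (A - B))"
          using mult_right_mono[OF c \<rho>.measure_nonneg[OF B]] by (simp add: algebra_simps)
        finally show ?thesis using c by (simp add: field_simps)
      qed
      ultimately show "J (\<nu> n) + \<rho> A / c \<le> \<nu> n B + \<rho> B + \<mu> (\<Omega> - B)"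
        using Jle[OF \<nu>(1)[of n] sets(1)] by linarith
    qed
    also have "\<dots> \<le> s" unfolding s_def by (rule cSUP_upper[OF add[OF \<nu>(1) \<rho>(1)] bdd])
    finally show False using \<nu>(2)[of n] n by linarith
  qed
  then show thesis using that \<nu>(1) by blast
qed

section \<open>Positive continuous functionals on the integrable functions\<close>

text \<open>The continuity constant is a parameter so that series of functionals can be controlled.
  Positivity is demanded on simple functions only, which is what separation from \<open>K\<close>
  minus the simple cone provides.\<close>

definition dominated_functional :: "(('a \<Rightarrow> real) \<Rightarrow> real) \<Rightarrow> real \<Rightarrow> bool" where
  "dominated_functional \<phi> c \<longleftrightarrow> linear_functional_on integrable\<^sub>f \<phi> \<and>
     (\<forall>f\<in>integrable\<^sub>f. \<bar>\<phi> f\<bar> \<le> c * norm\<^sub>1 f) \<and> (\<forall>s\<in>simple_fun_pos \<Omega> \<A>. 0 \<le> \<phi> s)"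

lemma linear_functional_on_iff:
  "linear_functional_on V \<phi> \<longleftrightarrow> (\<forall>f\<in>V. \<forall>g\<in>V. \<phi> (\<lambda>x. f x + g x) = \<phi> f + \<phi> g) \<and>
     (\<forall>f\<in>V. \<forall>a. \<phi> (\<lambda>x. a * f x) = a * \<phi> f)" for V :: "('a \<Rightarrow> real) set"
  by (simp add: linear_functional_on_def plus_fun_def scaleR_fun_def)

lemma subspace_L1: "subspace integrable\<^sub>f"
  using L1_simple[OF simple_const[of 0]] L1_add L1_cmult
  by (simp add: subspace_def plus_fun_def zero_fun_def scaleR_fun_def)

lemma seminorm_L1: "seminorm_on integrable\<^sub>f norm\<^sub>1"
  using L1_norm_nonneg L1_norm_triangle L1_norm_cmult
  by (simp add: seminorm_on_def plus_fun_def scaleR_fun_def)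

context
  fixes \<phi> c assumes \<phi>: "dominated_functional \<phi> c"
begin

lemma dominated_functional_add:
  "f \<in> integrable\<^sub>f \<Longrightarrow> g \<in> integrable\<^sub>f \<Longrightarrow> \<phi> (\<lambda>x. f x + g x) = \<phi> f + \<phi> g"
  using \<phi> by (simp add: dominated_functional_def linear_functional_on_iff)

lemma dominated_functional_cmult: "f \<in> integrable\<^sub>f \<Longrightarrow> \<phi> (\<lambda>x. a * f x) = a * \<phi> f"
  using \<phi> by (simp add: dominated_functional_def linear_functional_on_iff)

lemma dominated_functional_diff:
  "f \<in> integrable\<^sub>f \<Longrightarrow> g \<in> integrable\<^sub>f \<Longrightarrow> \<phi> (\<lambda>x. f x - g x) = \<phi> f - \<phi> g"
  using dominated_functional_add[of f "\<lambda>x. - 1 * g x"] dominated_functional_cmult[of g "- 1"] L1_cmult[of g "- 1"]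
  by simp

lemma dominated_functional_le: "f \<in> integrable\<^sub>f \<Longrightarrow> \<bar>\<phi> f\<bar> \<le> c * norm\<^sub>1 f"
  using \<phi> by (simp add: dominated_functional_def)

lemma dominated_functional_nonneg: "s \<in> simple \<Longrightarrow> (\<And>x. x \<in> \<Omega> \<Longrightarrow> 0 \<le> s x) \<Longrightarrow> 0 \<le> \<phi> s"
  using \<phi> by (simp add: dominated_functional_def simple_fun_pos_iff)

text \<open>Vectors are functions on the whole type; continuity makes the functional blind to values
  outside \<Omega>.\<close>

lemma dominated_functional_cong:
  assumes "f \<in> integrable\<^sub>f" "\<And>x. x \<in> \<Omega> \<Longrightarrow> f x = g x"
  shows "\<phi> f = \<phi> g"
proof -
  have g: "g \<in> integrable\<^sub>f" by (rule L1_cong[OF assms])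
  have "norm\<^sub>1 (\<lambda>x. f x - g x) = 0"
    by (rule L1_norm_null_eq[OF assms(1) g null_eq_cong[OF assms(2)]])
  then show ?thesis
    using dominated_functional_le[OF L1_diff[OF assms(1) g]] dominated_functional_diff[OF assms(1) g] by simp
qed

lemma dominated_functional_ba_pos: "(\<lambda>A. \<phi> (indicator A)) \<in> ba_pos \<A>"
proof (rule ba_posI[OF algebra_axioms])
  fix A B assume A: "A \<in> \<A>" and B: "B \<in> \<A>" and disj: "A \<inter> B = {}"
  have "indicator (A \<union> B) = (\<lambda>x. indicator A x + indicator B x :: real)"
    using disj by (auto simp: indicator_def fun_eq_iff)
  then show "\<phi> (indicator (A \<union> B)) = \<phi> (indicator A) + \<phi> (indicator B)"
    using dominated_functional_add[OF L1_simple L1_simple, OF simple_indicator[OF A] simple_indicator[OF B]] by simp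
next
  fix A assume "A \<in> \<A>"
  then show "0 \<le> \<phi> (indicator A)" by (intro dominated_functional_nonneg simple_indicator) auto
qed

lemma dominated_functional_indicator_le:
  assumes "A \<in> \<A>"
  shows "\<phi> (indicator A) \<le> c * \<mu> A"
proof -
  have "norm\<^sub>1 (indicator A) = \<mu> A"
    using fa_integral_simple[OF simple_indicator[OF assms]] sint_indicator[OF assms] by (simp add: L1_norm_def)
  then show ?thesis using dominated_functional_le[OF L1_simple[OF simple_indicator[OF assms]]] by simp
qed

lemma dominated_functional_simple:
  assumes s: "s \<in> simple"
  shows "\<phi> s = simple_fun_integral \<Omega> (\<lambda>A. \<phi> (indicator A)) s"
proof -
  let ?L = "\<lambda>y. {x \<in> \<Omega>. s x = y}"
  have fin: "finite (s ` \<Omega>)" and L: "?L y \<in> \<A>" for y using s by (auto simp: simple_iff finite_level_sets_def)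
  have sum: "(\<lambda>x. \<Sum>y\<in>I. y * indicator (?L y) x) \<in> integrable\<^sub>f \<and>
      \<phi> (\<lambda>x. \<Sum>y\<in>I. y * indicator (?L y) x) = (\<Sum>y\<in>I. y * \<phi> (indicator (?L y)))"
    if "finite I" for I
    using that
  proof (induction I rule: finite_induct)
    case empty
    show ?case
      using L1_simple[OF simple_const[of 0]] dominated_functional_cmult[OF L1_simple[OF simple_const[of 0]], of 0] by simp
  next
    case (insert y I)
    have i: "indicator (?L y) \<in> integrable\<^sub>f" by (rule L1_simple[OF simple_indicator[OF L]])
    note yi = L1_cmult[OF i, of y]
    show ?case
      unfolding sum.insert[OF insert(1,2)]
      using L1_add[OF yi conjunct1[OF insert.IH]] dominated_functional_add[OF yi conjunct1[OF insert.IH]]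
        dominated_functional_cmult[OF i, of y] conjunct2[OF insert.IH] by simp
  qed
  have "s x = (\<Sum>y\<in>s ` \<Omega>. y * indicator (?L y) x)" if x: "x \<in> \<Omega>" for x
  proof -
    have "(\<Sum>y\<in>s ` \<Omega>. y * indicator (?L y) x) = (\<Sum>y\<in>s ` \<Omega>. if y = s x then y else 0)"
      using x by (intro sum.cong) (auto simp: indicator_def)
    then show ?thesis using fin x by simp
  qed
  then have "\<phi> s = \<phi> (\<lambda>x. \<Sum>y\<in>s ` \<Omega>. y * indicator (?L y) x)"
    by (rule dominated_functional_cong[OF L1_simple[OF s]])
  then show ?thesis using sum[OF fin] by (simp add: simple_fun_integral_def)
qed

text \<open>The functional and the integral of its set function agree on simple functions, and a
  sequence determining \<open>f\<close> for \<mu> carries both sides to the limit: one by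
  continuity, the other by domination.\<close>

lemma dominated_functional_integral:
  assumes f: "f \<in> integrable\<^sub>f"
  shows "f \<in> L1 \<Omega> \<A> (\<lambda>A. \<phi> (indicator A))" "fa_integral \<Omega> \<A> (\<lambda>A. \<phi> (indicator A)) f = \<phi> f"
proof -
  let ?\<nu> = "\<lambda>A. \<phi> (indicator A)"
  interpret \<nu>: finitely_additive \<Omega> \<A> ?\<nu> using dominated_functional_ba_pos by (simp add: finitely_additive_iff)
  obtain F where F: "determining \<Omega> \<A> \<mu> F f" using f by (auto simp: L1_def)
  have s: "\<And>n. F n \<in> simple" using F by (simp add: determining_iff)
  \<comment> \<open>The transfer of determining sequences wants a positive constant, while
    \<open>c\<close> may have any sign.\<close>
  have "?\<nu> A \<le> max 1 c * \<mu> A" if "A \<in> \<A>" for A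
    using dominated_functional_indicator_le[OF that] mult_right_mono[OF _ measure_nonneg[OF that], of c "max 1 c"]
    by simp
  then have det: "determining \<Omega> \<A> ?\<nu> F f"
    by (intro determining_dominated[OF dominated_functional_ba_pos _ _ F, of "max 1 c"]) auto
  then show "f \<in> L1 \<Omega> \<A> ?\<nu>" by (auto simp: L1_def)
  have "(\<lambda>n. c * norm\<^sub>1 (\<lambda>x. f x - F n x)) \<longlonglongrightarrow> 0"
    using tendsto_mult_left[OF determining_norm_LIMSEQ[OF F], of c] by simp
  moreover have "norm (\<phi> f - \<phi> (F n)) \<le> c * norm\<^sub>1 (\<lambda>x. f x - F n x)" for n
    using dominated_functional_le[OF L1_diff[OF f L1_simple[OF s]]] dominated_functional_diff[OF f L1_simple[OF s]]
    by simp
  ultimately have "(\<lambda>n. \<phi> f - \<phi> (F n)) \<longlonglongrightarrow> 0"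
    by - (rule Lim_null_comparison[where g = "\<lambda>n. c * norm\<^sub>1 (\<lambda>x. f x - F n x)"], auto)
  from tendsto_diff[OF tendsto_const[of "\<phi> f"] this]
  have "(\<lambda>n. \<nu>.sint (F n)) \<longlonglongrightarrow> \<phi> f" by (simp add: dominated_functional_simple[OF s])
  then show "fa_integral \<Omega> \<A> ?\<nu> f = \<phi> f" by (rule LIMSEQ_unique[OF \<nu>.fa_integral_LIMSEQ[OF det]])
qed

end

section \<open>Sums and series of dominated functionals\<close>

lemma dominated_functional_scale:
  assumes "dominated_functional \<phi> c" "a \<ge> 0"
  shows "dominated_functional (\<lambda>f. a * \<phi> f) (a * c)"
  using assms mult_left_mono[OF dominated_functional_le[OF assms(1)] assms(2)]
  by (simp add: dominated_functional_def linear_functional_on_iff distrib_left abs_mult mult.assoc mult.left_commute)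

lemma dominated_functional_plus:
  assumes "dominated_functional \<phi> c" "dominated_functional \<psi> d"
  shows "dominated_functional (\<lambda>f. \<phi> f + \<psi> f) (c + d)"
proof -
  have "\<bar>\<phi> f + \<psi> f\<bar> \<le> (c + d) * norm\<^sub>1 f" if "f \<in> integrable\<^sub>f" for f
    using dominated_functional_le[OF assms(1) that] dominated_functional_le[OF assms(2) that]
      abs_triangle_ineq[of "\<phi> f" "\<psi> f"] by (simp add: algebra_simps)
  then show ?thesis using assms
    by (simp add: dominated_functional_def linear_functional_on_iff algebra_simps)
qed

lemma dominated_functional_suminf:
  fixes \<phi> :: "nat \<Rightarrow> ('a \<Rightarrow> real) \<Rightarrow> real"
  assumes \<phi>: "\<And>n. dominated_functional (\<phi> n) (b n)" and b: "summable b"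
  shows "\<And>f. f \<in> integrable\<^sub>f \<Longrightarrow> summable (\<lambda>n. \<phi> n f)"
    and "dominated_functional (\<lambda>f. \<Sum>n. \<phi> n f) (suminf b)"
proof -
  have le: "norm (\<phi> n f) \<le> b n * norm\<^sub>1 f" if "f \<in> integrable\<^sub>f" for n f
    using dominated_functional_le[OF \<phi> that] by simp
  have sb: "summable (\<lambda>n. b n * norm\<^sub>1 f)" for f using b by (rule summable_mult2)
  show sum: "summable (\<lambda>n. \<phi> n f)" if "f \<in> integrable\<^sub>f" for f
    using le[OF that] by (intro summable_comparison_test[OF _ sb]) auto
  have "(\<Sum>n. \<phi> n (\<lambda>x. f x + g x)) = (\<Sum>n. \<phi> n f) + (\<Sum>n. \<phi> n g)"
    if "f \<in> integrable\<^sub>f" "g \<in> integrable\<^sub>f" for f g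
    using suminf_add[OF sum sum] that by (simp add: dominated_functional_add[OF \<phi>])
  moreover have "(\<Sum>n. \<phi> n (\<lambda>x. a * f x)) = a * (\<Sum>n. \<phi> n f)" if "f \<in> integrable\<^sub>f" for f a
    using suminf_mult[OF sum] that by (simp add: dominated_functional_cmult[OF \<phi>])
  moreover have "\<bar>\<Sum>n. \<phi> n f\<bar> \<le> suminf b * norm\<^sub>1 f" if "f \<in> integrable\<^sub>f" for f
  proof -
    have "norm (\<Sum>n. \<phi> n f) \<le> (\<Sum>n. b n * norm\<^sub>1 f)" by (rule norm_suminf_le[OF le[OF that] sb])
    then show ?thesis using suminf_mult2[OF b] by simp
  qed
  moreover have "0 \<le> (\<Sum>n. \<phi> n s)" if "s \<in> simple_fun_pos \<Omega> \<A>" for s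
    using that \<phi> by (intro suminf_nonneg sum L1_simple) (auto simp: dominated_functional_def simple_fun_pos_iff)
  ultimately show "dominated_functional (\<lambda>f. \<Sum>n. \<phi> n f) (suminf b)"
    by (simp add: dominated_functional_def linear_functional_on_iff)
qed

text \<open>The admissible set functions are closed under addition because norms and upper bounds on
  \<open>K\<close> add. The countable family extracted from them is turned back into functionals and
  summed.\<close>

lemma charging_functional:
  assumes K: "K \<subseteq> integrable\<^sub>f" and \<Omega>: "\<mu> \<Omega> > 0"
    and charge: "\<And>A. A \<in> \<A> \<Longrightarrow> \<mu> A > 0 \<Longrightarrow>
      \<exists>\<phi> c. dominated_functional \<phi> c \<and> bdd_above (\<phi> ` K) \<and> \<phi> (indicator A) > 0"
  obtains \<phi> c where "dominated_functional \<phi> c" "bdd_above (\<phi> ` K)"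
    "\<And>A. A \<in> \<A> \<Longrightarrow> \<mu> A > 0 \<Longrightarrow> \<phi> (indicator A) > 0"
proof -
  define M where "M = {\<lambda>A. \<phi> (indicator A) | \<phi>. \<exists>c. dominated_functional \<phi> c \<and> bdd_above (\<phi> ` K)}"
  have M1: "M \<noteq> {}" using charge[OF top \<Omega>] by (auto simp: M_def)
  have M2: "M \<subseteq> ba_pos \<A>" using dominated_functional_ba_pos by (auto simp: M_def)
  have M3: "(\<lambda>A. \<nu> A + \<nu>' A) \<in> M" if \<nu>: "\<nu> \<in> M" "\<nu>' \<in> M" for \<nu> \<nu>'
  proof -
    obtain \<phi> c \<psi> d where \<phi>: "dominated_functional \<phi> c" "bdd_above (\<phi> ` K)" "\<nu> = (\<lambda>A. \<phi> (indicator A))"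
      and \<psi>: "dominated_functional \<psi> d" "bdd_above (\<psi> ` K)" "\<nu>' = (\<lambda>A. \<psi> (indicator A))"
      using \<nu> by (auto simp: M_def)
    obtain a b where "\<And>k. k \<in> K \<Longrightarrow> \<phi> k \<le> a" "\<And>k. k \<in> K \<Longrightarrow> \<psi> k \<le> b"
      using \<phi>(2) \<psi>(2) by (auto simp: bdd_above_def)
    then have "bdd_above ((\<lambda>f. \<phi> f + \<psi> f) ` K)" by (intro bdd_aboveI2[where M = "a + b"] add_mono)
    then show ?thesis unfolding M_def \<phi>(3) \<psi>(3)
      using dominated_functional_plus[OF \<phi>(1) \<psi>(1)] by (intro CollectI exI[of _ "\<lambda>f. \<phi> f + \<psi> f"]) auto
  qed
  have M4: "\<exists>c. \<forall>A\<in>\<A>. \<nu> A \<le> c * \<mu> A" if "\<nu> \<in> M" for \<nu>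
    using that dominated_functional_indicator_le by (auto simp: M_def)
  have M5: "\<exists>\<nu>\<in>M. \<nu> A > 0" if "A \<in> \<A>" "\<mu> A > 0" for A
    using charge[OF that] by (auto simp: M_def)
  obtain \<nu> where \<nu>: "\<And>n. \<nu> n \<in> M" "\<And>A. A \<in> \<A> \<Longrightarrow> \<mu> A > 0 \<Longrightarrow> \<exists>n::nat. \<nu> n A > 0"
    using countable_charging_subfamily[OF M1 M2 M3 M4 M5] by blast
  have "\<forall>n. \<exists>\<phi> c b. \<nu> n = (\<lambda>A. \<phi> (indicator A)) \<and> dominated_functional \<phi> c \<and> (\<forall>k\<in>K. \<phi> k \<le> b)"
    using \<nu>(1) by (fastforce simp: M_def bdd_above_def)
  then obtain \<phi> c b where \<nu>\<phi>: "\<And>n. \<nu> n = (\<lambda>A. \<phi> n (indicator A))"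
    and \<phi>: "\<And>n. dominated_functional (\<phi> n) (c n)" and b: "\<And>n k. k \<in> K \<Longrightarrow> \<phi> n k \<le> b n"
    by metis
  \<comment> \<open>One weight makes both \<open>w n * c n\<close> and \<open>w n * b n\<close> at
    most \<open>(1 / 2) ^ n\<close>; the summand 1 keeps the denominator positive.\<close>
  define w where "w n = (1 / 2) ^ n / (1 + \<bar>c n\<bar> + \<bar>b n\<bar>)" for n
  have w: "w n > 0" for n by (auto simp: w_def intro!: divide_pos_pos add_pos_nonneg)
  have wle: "w n * y \<le> (1 / 2) ^ n" if "y \<le> \<bar>c n\<bar> + \<bar>b n\<bar>" for n y
  proof -
    have "(1 / 2) ^ n * y \<le> (1 / 2) ^ n * (1 + \<bar>c n\<bar> + \<bar>b n\<bar>)" using that by (intro mult_left_mono) auto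
    then show ?thesis by (simp add: w_def divide_le_eq add_pos_nonneg)
  qed
  define \<Phi> where "\<Phi> f = (\<Sum>n. w n * \<phi> n f)" for f
  have dom: "dominated_functional (\<lambda>f. w n * \<phi> n f) ((1 / 2) ^ n)" for n
  proof -
    have 1: "dominated_functional (\<lambda>f. w n * \<phi> n f) (w n * c n)"
      using dominated_functional_scale[OF \<phi> less_imp_le[OF w]] .
    have "\<bar>w n * \<phi> n f\<bar> \<le> (1 / 2) ^ n * norm\<^sub>1 f" if f: "f \<in> integrable\<^sub>f" for f
    proof -
      have "\<bar>w n * \<phi> n f\<bar> \<le> w n * c n * norm\<^sub>1 f" using dominated_functional_le[OF 1 f] .
      also have "\<dots> \<le> (1 / 2) ^ n * norm\<^sub>1 f" by (intro mult_right_mono wle L1_norm_nonneg f) auto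
      finally show ?thesis .
    qed
    then show ?thesis using 1 by (simp add: dominated_functional_def)
  qed
  have geo: "summable (\<lambda>n. (1 / 2 :: real) ^ n)" by (rule summable_geometric) simp
  note sum = dominated_functional_suminf(1)[OF dom geo]
  have \<Phi>: "dominated_functional \<Phi> (\<Sum>n. (1 / 2) ^ n)"
    unfolding \<Phi>_def by (rule dominated_functional_suminf(2)[OF dom geo])
  have "\<Phi> k \<le> (\<Sum>n. (1 / 2) ^ n)" if k: "k \<in> K" for k
  proof -
    have "w n * \<phi> n k \<le> (1 / 2) ^ n" for n using b[OF k, of n] by (intro wle) auto
    then show ?thesis unfolding \<Phi>_def using K k by (intro suminf_le sum geo) auto
  qed
  then have "bdd_above (\<Phi> ` K)" by (intro bdd_aboveI2)
  moreover have "\<Phi> (indicator A) > 0" if A: "A \<in> \<A>" "\<mu> A > 0" for A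
  proof -
    obtain n where "\<phi> n (indicator A) > 0" using \<nu>(2)[OF A] \<nu>\<phi> by auto
    then have "0 < w n * \<phi> n (indicator A)" using w by simp
    moreover have "0 \<le> w m * \<phi> m (indicator A)" for m
      using dominated_functional_nonneg[OF dom simple_indicator[OF A(1)]] by simp
    ultimately show ?thesis
      unfolding \<Phi>_def by (intro suminf_pos2[OF sum[OF L1_simple[OF simple_indicator[OF A(1)]]]])
  qed
  ultimately show thesis using that \<Phi> by blast
qed

section \<open>Separation from the closure, level sets and stability of the closure\<close>

lemma minus_simple_subset_L1: "K \<subseteq> integrable\<^sub>f \<Longrightarrow> minus_simple \<Omega> \<A> K \<subseteq> integrable\<^sub>f"
  by (auto simp: minus_simple_def simple_fun_pos_iff intro!: L1_diff intro: L1_simple)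

text \<open>A point outside the closure has positive distance \<delta> from the set, and separation
  applies. A functional bounded by 1 on a set containing \<open>z\<close> minus all multiples of a
  nonnegative simple function cannot be negative at that function.\<close>

lemma separating_functional:
  assumes K: "K \<subseteq> integrable\<^sub>f" and convex: "L1_convex \<Omega> \<A> \<mu> K"
    and z: "z \<in> K" "null_eq \<Omega> \<A> \<mu> (\<lambda>_. 0) z"
    and g: "g \<in> integrable\<^sub>f" "g \<notin> L1_closure \<Omega> \<A> \<mu> (minus_simple \<Omega> \<A> K)"
  obtains \<phi> c where "dominated_functional \<phi> c" "bdd_above (\<phi> ` K)" "\<phi> g > 0"
proof -
  let ?C = "minus_simple \<Omega> \<A> K"
  have CI: "(\<lambda>x. k x - s x) \<in> ?C" if "k \<in> K" "s \<in> simple" "\<And>x. x \<in> \<Omega> \<Longrightarrow> 0 \<le> s x" for k s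
    using that by (auto simp: minus_simple_def simple_fun_pos_iff)
  have CE: "\<exists>k s. k \<in> K \<and> s \<in> simple \<and> (\<forall>x\<in>\<Omega>. 0 \<le> s x) \<and> c = (\<lambda>x. k x - s x)" if "c \<in> ?C" for c
    using that by (auto simp: minus_simple_def simple_fun_pos_iff)
  have KC: "K \<subseteq> ?C"
    using CI[OF _ simple_const[of 0]] by auto
  have C: "?C \<subseteq> integrable\<^sub>f" using K by (rule minus_simple_subset_L1)
  have norm_z: "norm\<^sub>1 z = 0"
    using L1_norm_null_eq[OF L1_simple[OF simple_const] _ z(2)] z(1) K by (auto simp: L1_norm_def)
  obtain \<delta> where \<delta>: "\<delta> > 0" "\<And>c. c \<in> ?C \<Longrightarrow> \<delta> \<le> norm\<^sub>1 (g - c)"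
    using g by (auto simp: L1_closure_def fun_diff_def not_less)
  \<comment> \<open>The simple parts combine exactly; convexity of \<open>K\<close> contributes an
    error of seminorm zero.\<close>
  have conv: "\<exists>h\<in>?C. norm\<^sub>1 ((1 - t) *\<^sub>R x + t *\<^sub>R y - h) = 0"
    if x: "x \<in> ?C" and y: "y \<in> ?C" and t: "0 \<le> t" "t \<le> 1" for x y t
  proof -
    obtain k s where k: "k \<in> K" "s \<in> simple" "\<forall>u\<in>\<Omega>. 0 \<le> s u" "x = (\<lambda>u. k u - s u)" using CE[OF x] by blast
    obtain l r where l: "l \<in> K" "r \<in> simple" "\<forall>u\<in>\<Omega>. 0 \<le> r u" "y = (\<lambda>u. l u - r u)" using CE[OF y] by blast
    obtain h where h: "h \<in> K" "null_eq \<Omega> \<A> \<mu> (\<lambda>u. (1 - t) * k u + t * l u) h"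
      using convex k(1) l(1) t unfolding L1_convex_def by blast
    let ?s = "\<lambda>u. (1 - t) * s u + t * r u"
    have s: "?s \<in> simple" using k(2) l(2) by (rule simple_comp2)
    have "(\<lambda>u. (1 - t) * k u + t * l u) \<in> integrable\<^sub>f"
      using k(1) l(1) K by (intro L1_add L1_cmult) auto
    then have "norm\<^sub>1 (\<lambda>u. ((1 - t) * k u + t * l u) - h u) = 0"
      using h K by (intro L1_norm_null_eq) auto
    moreover have "(1 - t) *\<^sub>R x + t *\<^sub>R y - (\<lambda>u. h u - ?s u) = (\<lambda>u. ((1 - t) * k u + t * l u) - h u)"
      by (simp add: k(4) l(4) fun_eq_iff scaleR_fun_def algebra_simps)
    moreover have "(\<lambda>u. h u - ?s u) \<in> ?C" using k l t by (intro CI[OF h(1) s]) auto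
    ultimately show ?thesis by (intro bexI[of _ "\<lambda>u. h u - ?s u"]) simp_all
  qed
  obtain \<phi> where \<phi>: "linear_functional_on integrable\<^sub>f \<phi>"
      "\<And>x. x \<in> integrable\<^sub>f \<Longrightarrow> \<bar>\<phi> x\<bar> \<le> norm\<^sub>1 x / \<delta>" "\<And>c. c \<in> ?C \<Longrightarrow> \<phi> c \<le> 1" "1 \<le> \<phi> g"
    using seminorm_separation[where p = "norm\<^sub>1", OF subspace_L1 seminorm_L1 C conv subsetD[OF KC z(1)] norm_z g(1) \<delta>(1) \<delta>(2)]
    by blast
  have \<phi>z: "\<phi> z = 0" using \<phi>(2)[of z] norm_z z(1) K by auto
  have "0 \<le> \<phi> s" if s: "s \<in> simple_fun_pos \<Omega> \<A>" for s
  proof (rule ccontr)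
    assume "\<not> 0 \<le> \<phi> s"
    then have neg: "\<phi> s < 0" by simp
    \<comment> \<open>Chosen so that the value at \<open>z - a * s\<close> is 2, above the bound
      1.\<close>
    define a where "a = - 2 / \<phi> s"
    have a: "a > 0" using neg by (simp add: a_def field_simps)
    have sL: "s \<in> simple" using s by (simp add: simple_fun_pos_iff)
    have as: "(\<lambda>x. a * s x) \<in> simple" using sL by (rule simple_comp)
    have "(\<lambda>x. z x - a * s x) \<in> ?C" using a s by (intro CI[OF z(1) as]) (auto simp: simple_fun_pos_iff)
    then have "\<phi> (\<lambda>x. z x - a * s x) \<le> 1" by (rule \<phi>(3))
    also have "(\<lambda>x. z x - a * s x) = (\<lambda>x. z x + (- a) * s x)" by simp
    also have "\<phi> \<dots> = \<phi> z + (- a) * \<phi> s"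
      using \<phi>(1) z(1) K L1_simple[OF sL] L1_cmult[OF L1_simple[OF sL], of "- a"]
      unfolding linear_functional_on_iff by (metis subsetD)
    also have "\<dots> = 2" using \<phi>z neg by (simp add: a_def)
    finally show False by simp
  qed
  then have "dominated_functional \<phi> (1 / \<delta>)" using \<phi>(1,2) by (simp add: dominated_functional_def)
  moreover have "bdd_above (\<phi> ` K)" using \<phi>(3) KC by (intro bdd_aboveI2[where M = 1]) auto
  ultimately show thesis using that \<phi>(4) by force
qed

text \<open>Level sets of \<open>f\<close> need not belong to the algebra, so \<open>A\<close> is
  taken from a simple approximant \<open>F n\<close>: the set where its modulus exceeds
  \<open>2 * \<delta>\<close>, less the exceptional set \<open>E\<close>.\<close>

lemma integrable_charges_level_set:
  assumes f: "f \<in> integrable\<^sub>f" and pos: "integral\<^sub>f (\<lambda>x. \<bar>f x\<bar>) > 0"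
  obtains A \<delta> where "A \<in> \<A>" "\<mu> A > 0" "\<delta> > 0" "\<And>x. x \<in> A \<Longrightarrow> \<delta> \<le> \<bar>f x\<bar>"
proof -
  define I where "I = integral\<^sub>f (\<lambda>x. \<bar>f x\<bar>)"
  have I: "I > 0" using pos by (simp add: I_def)
  obtain F where F: "determining \<Omega> \<A> \<mu> F f" using f by (auto simp: L1_def)
  have s: "\<And>n. F n \<in> simple" and Cauchy: "mean_Cauchy F" and conv: "converges F f"
    using F by (auto simp: determining_iff)
  have "determining \<Omega> \<A> \<mu> (\<lambda>n x. \<bar>F n x\<bar>) (\<lambda>x. \<bar>f x\<bar>)"
    by (rule determining_lipschitz[OF F F, of 1]) auto
  then have lim: "(\<lambda>n. sint (\<lambda>x. \<bar>F n x\<bar>)) \<longlonglongrightarrow> I"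
    unfolding I_def by (rule fa_integral_LIMSEQ)
  obtain N M where M: "M > 0" and N: "\<And>n \<delta>. n \<ge> N \<Longrightarrow> \<delta> \<ge> 0 \<Longrightarrow>
      sint (\<lambda>x. \<bar>F n x\<bar>) \<le> I / 8 + \<delta> * \<mu> \<Omega> + M * \<mu> {x \<in> \<Omega>. \<bar>F n x\<bar> > \<delta>}"
    by (rule mean_Cauchy_uniformly_integrable[OF Cauchy s, of "I / 8"]) (use I in auto)
  have \<Omega>: "0 \<le> \<mu> \<Omega>" by (rule measure_nonneg[OF top])
  \<comment> \<open>This keeps \<open>2 * \<delta> * \<mu> \<Omega>\<close> within
    \<open>I / 8\<close>. Of the lower bound \<open>I / 2\<close> for the integral of the modulus of
    \<open>F n\<close>, more than \<open>I / 4\<close> is then left for the term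
    \<open>M * \<mu> ?B\<close>.\<close>
  define \<delta> where "\<delta> = I / 16 / (\<mu> \<Omega> + 1)"
  have \<delta>: "\<delta> > 0" using I \<Omega> by (simp add: \<delta>_def)
  have "\<delta> * (\<mu> \<Omega> + 1) = I / 16"
    unfolding \<delta>_def using \<Omega> by (intro nonzero_eq_divide_eq[THEN iffD1]) auto
  then have \<delta>2: "2 * \<delta> * \<mu> \<Omega> \<le> I / 8" using \<delta> by (simp add: algebra_simps)
  \<comment> \<open>The bound \<open>r \<le> \<delta>\<close> keeps the modulus of \<open>f\<close>
    at least \<delta> off \<open>E\<close>; \<open>M * r \<le> I / 4\<close> makes \<open>E\<close>
    lighter than \<open>?B\<close>.\<close>
  define r where "r = min \<delta> (I / 4 / M)"
  have r: "r > 0" "r \<le> \<delta>" "M * r \<le> I / 4" using \<delta> I M by (auto simp: r_def min_def field_simps)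
  have "\<forall>\<^sub>F n in sequentially. I / 2 < sint (\<lambda>x. \<bar>F n x\<bar>)" using lim I by (intro order_tendstoD) auto
  moreover have "\<forall>\<^sub>F n in sequentially. close r (F n) f" using conv r(1) by (simp add: conv_in_measure_iff)
  ultimately have "\<forall>\<^sub>F n in sequentially. I / 2 < sint (\<lambda>x. \<bar>F n x\<bar>) \<and> close r (F n) f \<and> n \<ge> N"
    using eventually_ge_at_top[of N] by eventually_elim auto
  then obtain n where n: "I / 2 < sint (\<lambda>x. \<bar>F n x\<bar>)" "close r (F n) f" "n \<ge> N"
    by (auto dest: eventually_happens)
  obtain E where E: "E \<in> \<A>" "\<mu> E < r" "\<And>x. x \<in> \<Omega> - E \<Longrightarrow> \<bar>F n x - f x\<bar> \<le> r"
    using n(2) unfolding close_def by blast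
  let ?B = "{x \<in> \<Omega>. \<bar>F n x\<bar> > 2 * \<delta>}"
  have B: "?B \<in> \<A>" using s by (rule simple_level_set)
  have "I / 4 < M * \<mu> ?B" using N[OF n(3), of "2 * \<delta>"] \<delta> \<delta>2 n(1) by linarith
  then have "M * r < M * \<mu> ?B" using r(3) by linarith
  then have "r < \<mu> ?B" using M by simp
  moreover have "\<mu> ?B \<le> \<mu> (?B - E) + \<mu> E"
    using measure_split[OF B E(1)] measure_mono[of "?B \<inter> E" E] B E(1) by auto
  ultimately have "\<mu> (?B - E) > 0" using E(2) by linarith
  moreover have "\<delta> \<le> \<bar>f x\<bar>" if "x \<in> ?B - E" for x using E(3)[of x] that r(2) by auto
  ultimately show thesis using that[of "?B - E" \<delta>] B E(1) \<delta> by blast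
qed

text \<open>The set itself is stable under subtracting nonnegative simple functions; those are dense
  among nonnegative integrable ones, since approximants may be replaced by their absolute values,
  and the closure absorbs the error.\<close>

lemma L1_closure_minus_nonneg:
  assumes K: "K \<subseteq> integrable\<^sub>f" and f: "f \<in> L1_closure \<Omega> \<A> \<mu> (minus_simple \<Omega> \<A> K)"
    and g: "g \<in> integrable\<^sub>f" "\<And>x. x \<in> \<Omega> \<Longrightarrow> 0 \<le> g x"
  shows "(\<lambda>x. f x - g x) \<in> L1_closure \<Omega> \<A> \<mu> (minus_simple \<Omega> \<A> K)"
  unfolding L1_closure_def
proof (intro CollectI conjI allI impI)
  have fL: "f \<in> integrable\<^sub>f" using f by (simp add: L1_closure_def)
  show "(\<lambda>x. f x - g x) \<in> integrable\<^sub>f" by (rule L1_diff[OF fL g(1)])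
  fix \<epsilon> :: real assume \<epsilon>: "\<epsilon> > 0"
  obtain k s where k: "k \<in> K" and s: "s \<in> simple" "\<And>x. x \<in> \<Omega> \<Longrightarrow> 0 \<le> s x"
    and ks: "norm\<^sub>1 (\<lambda>x. f x - (k x - s x)) < \<epsilon> / 2"
    using f \<epsilon> unfolding L1_closure_def minus_simple_def simple_fun_pos_iff
    by (force dest!: spec[of _ "\<epsilon> / 2"])
  obtain G where G: "determining \<Omega> \<A> \<mu> G g" using g(1) by (auto simp: L1_def)
  have "determining \<Omega> \<A> \<mu> (\<lambda>n x. \<bar>G n x\<bar>) g"
    using g(2) by - (rule determining_lipschitz[OF G G, of 1], auto)
  from order_tendstoD(2)[OF determining_norm_LIMSEQ[OF this], of "\<epsilon> / 2"] \<epsilon>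
  obtain n where n: "norm\<^sub>1 (\<lambda>x. g x - \<bar>G n x\<bar>) < \<epsilon> / 2" by (auto dest: eventually_happens)
  have Gn: "(\<lambda>x. \<bar>G n x\<bar>) \<in> simple" using G simple_comp[of "G n" abs] by (simp add: determining_iff)
  let ?s = "\<lambda>x. s x + \<bar>G n x\<bar>"
  have "?s \<in> simple" using s(1) Gn by (rule simple_comp2)
  then have "?s \<in> simple_fun_pos \<Omega> \<A>" using s(2) by (auto simp: simple_fun_pos_iff)
  then have C: "(\<lambda>x. k x - ?s x) \<in> minus_simple \<Omega> \<A> K" using k by (auto simp: minus_simple_def)
  have a: "(\<lambda>x. f x - (k x - s x)) \<in> integrable\<^sub>f" using k K by (intro L1_diff fL L1_simple[OF s(1)]) auto
  have b: "(\<lambda>x. g x - \<bar>G n x\<bar>) \<in> integrable\<^sub>f" by (intro L1_diff g(1) L1_simple[OF Gn])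
  have "norm\<^sub>1 (\<lambda>x. (f x - g x) - (k x - ?s x)) =
      norm\<^sub>1 (\<lambda>x. (f x - (k x - s x)) + (- 1) * (g x - \<bar>G n x\<bar>))"
    by (rule arg_cong[of _ _ "norm\<^sub>1"]) auto
  also have "\<dots> \<le> norm\<^sub>1 (\<lambda>x. f x - (k x - s x)) + norm\<^sub>1 (\<lambda>x. (- 1) * (g x - \<bar>G n x\<bar>))"
    by (rule L1_norm_triangle[OF a L1_cmult[OF b]])
  also have "norm\<^sub>1 (\<lambda>x. (- 1) * (g x - \<bar>G n x\<bar>)) = norm\<^sub>1 (\<lambda>x. g x - \<bar>G n x\<bar>)"
    using L1_norm_cmult[OF b, of "- 1"] by simp
  finally have "norm\<^sub>1 (\<lambda>x. (f x - g x) - (k x - ?s x)) < \<epsilon>" using ks n by linarith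
  then show "\<exists>c\<in>minus_simple \<Omega> \<A> K. norm\<^sub>1 (\<lambda>x. f x - g x - c x) < \<epsilon>" by (rule bexI[OF _ C])
qed

lemma L1_closure_norm_eq:
  assumes C: "C \<subseteq> integrable\<^sub>f" and f: "f \<in> L1_closure \<Omega> \<A> \<mu> C"
    and g: "g \<in> integrable\<^sub>f" "norm\<^sub>1 (\<lambda>x. g x - f x) = 0"
  shows "g \<in> L1_closure \<Omega> \<A> \<mu> C"
  unfolding L1_closure_def
proof (intro CollectI conjI allI impI g(1))
  fix \<epsilon> :: real assume "\<epsilon> > 0"
  then obtain c where c: "c \<in> C" "norm\<^sub>1 (\<lambda>x. f x - c x) < \<epsilon>" using f by (auto simp: L1_closure_def)
  have fL: "f \<in> integrable\<^sub>f" using f by (simp add: L1_closure_def)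
  have "norm\<^sub>1 (\<lambda>x. (g x - f x) + (f x - c x)) \<le> norm\<^sub>1 (\<lambda>x. g x - f x) + norm\<^sub>1 (\<lambda>x. f x - c x)"
    using c(1) C by (intro L1_norm_triangle L1_diff g(1) fL) auto
  then show "\<exists>c\<in>C. norm\<^sub>1 (\<lambda>x. g x - c x) < \<epsilon>" using c g(2) by (intro bexI[of _ c]) auto
qed

text \<open>Elements of \<open>L1_pos\<close> are nonnegative only modulo null functions, and this
  supplies an honestly nonnegative representative. Where \<open>f\<close> is negative, the change is
  twice its modulus, at most twice the distance to \<open>g\<close>.\<close>

lemma null_eq_abs:
  assumes g: "\<And>x. x \<in> \<Omega> \<Longrightarrow> 0 \<le> g x" and fg: "null_eq \<Omega> \<A> \<mu> f g"
  shows "null_eq \<Omega> \<A> \<mu> f (\<lambda>x. \<bar>f x\<bar>)"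
  unfolding null_eq_iff
proof (rule converges_lipschitz[of "\<lambda>_. f" g "\<lambda>_. f" g 1])
  show "\<bar>f x - \<bar>f x\<bar>\<bar> \<le> 1 * \<bar>f x - g x\<bar> + 1 * \<bar>f x - g x\<bar>" if "x \<in> \<Omega>" for x
    using g[OF that] by (auto simp: abs_if)
qed (use fg in \<open>auto simp: null_eq_iff\<close>)

end

section \<open>The equivalence\<close>

text \<open>Positivity of \<open>lam \<Omega>\<close> excludes the zero set function, for which (i)
  and (ii) hold vacuously while (c) contradicts \<open>P \<Omega> = 1\<close>.\<close>

theorem corollary3:
  fixes \<Omega> :: "'a set" and \<A> :: "'a set set" and lam :: "'a set \<Rightarrow> real"
    and K C\<^sub>c\<^sub>l :: "('a \<Rightarrow> real) set"
  assumes "algebra \<Omega> \<A>" and "\<Omega> \<noteq> {}"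
    and "lam \<in> ba_pos \<A>" and "lam \<Omega> > 0"
    and "K \<subseteq> L1 \<Omega> \<A> lam" and "L1_convex \<Omega> \<A> lam K"
    and "\<exists>z\<in>K. null_eq \<Omega> \<A> lam (\<lambda>_. 0) z"
  defines "C\<^sub>c\<^sub>l \<equiv> L1_closure \<Omega> \<A> lam (minus_simple \<Omega> \<A> K)"
  defines "cond_i \<equiv> \<forall>f\<in>L1_pos \<Omega> \<A> lam. fa_integral \<Omega> \<A> lam f > 0 \<longrightarrow>
                (\<exists>\<eta>>0. (\<lambda>x. \<eta> * f x) \<notin> C\<^sub>c\<^sub>l)"
  defines "cond_ii \<equiv> \<forall>A\<in>\<A>. lam A > 0 \<longrightarrow> (\<exists>d>0. (\<lambda>x. d * indicator A x) \<notin> C\<^sub>c\<^sub>l)"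
  defines "cond_iii \<equiv> \<exists>P. fa_prob \<Omega> \<A> P \<and>
                (K \<subseteq> L1 \<Omega> \<A> P \<and> bdd_above (fa_integral \<Omega> \<A> P ` K)) \<and>
                bdd_above {P A / lam A | A. A \<in> \<A> \<and> lam A > 0} \<and>
                (\<forall>A\<in>\<A>. P A = 0 \<longleftrightarrow> lam A = 0)"
  shows "(cond_i \<longleftrightarrow> cond_ii) \<and> (cond_ii \<longleftrightarrow> cond_iii)"
proof -
  interpret finitely_additive \<Omega> \<A> lam
    using assms(1,3) by (simp add: finitely_additive_def finitely_additive_axioms_def)
  note K = assms(5)
  obtain z where z: "z \<in> K" "null_eq \<Omega> \<A> lam (\<lambda>_. 0) z" using assms(7) by blast
  have ind: "(\<lambda>x. d * indicator A x) \<in> integrable\<^sub>f" if "A \<in> \<A>" for A d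
    by (rule L1_cmult[OF L1_simple[OF simple_indicator[OF that]]])
  have lam_pos: "lam A = 0 \<or> lam A > 0" if "A \<in> \<A>" for A
    using measure_nonneg[OF that] by auto
  have "cond_i \<Longrightarrow> cond_ii"
    unfolding cond_i_def cond_ii_def
  proof (intro ballI impI)
    fix A assume i: "\<forall>f\<in>L1_pos \<Omega> \<A> lam. fa_integral \<Omega> \<A> lam f > 0 \<longrightarrow> (\<exists>\<eta>>0. (\<lambda>x. \<eta> * f x) \<notin> C\<^sub>c\<^sub>l)"
      and A: "A \<in> \<A>" "lam A > 0"
    have "indicator A \<in> L1_pos \<Omega> \<A> lam"
      unfolding L1_pos_def using L1_simple[OF simple_indicator[OF A(1)]]
      by (auto intro!: exI[of _ "indicator A"] null_eq_cong)
    moreover have "integral\<^sub>f (indicator A) > 0"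
      using fa_integral_simple[OF simple_indicator[OF A(1)]] sint_indicator[OF A(1)] A(2) by simp
    ultimately show "\<exists>d>0. (\<lambda>x. d * indicator A x) \<notin> C\<^sub>c\<^sub>l" using i by blast
  qed
  moreover have "cond_ii \<Longrightarrow> cond_i"
    unfolding cond_i_def cond_ii_def
  proof (intro ballI impI)
    fix f assume ii: "\<forall>A\<in>\<A>. lam A > 0 \<longrightarrow> (\<exists>d>0. (\<lambda>x. d * indicator A x) \<notin> C\<^sub>c\<^sub>l)"
      and f: "f \<in> L1_pos \<Omega> \<A> lam" and pos: "fa_integral \<Omega> \<A> lam f > 0"
    have fL: "f \<in> integrable\<^sub>f" using f by (simp add: L1_pos_def)
    have null: "null_eq \<Omega> \<A> lam f (\<lambda>x. \<bar>f x\<bar>)" using f null_eq_abs by (auto simp: L1_pos_def)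
    have "integral\<^sub>f (\<lambda>x. \<bar>f x\<bar>) > 0" using fa_integral_null_eq(2)[OF fL null] pos by simp
    then obtain A \<delta> where A: "A \<in> \<A>" "lam A > 0" and \<delta>: "\<delta> > 0" "\<And>x. x \<in> A \<Longrightarrow> \<delta> \<le> \<bar>f x\<bar>"
      using integrable_charges_level_set[OF fL] by blast
    obtain d where d: "d > 0" "(\<lambda>x. d * indicator A x) \<notin> C\<^sub>c\<^sub>l" using ii A by blast
    \<comment> \<open>Scaled so that \<eta> times the modulus of \<open>f\<close> is at least
      \<open>d\<close> on \<open>A\<close>; subtracting the nonnegative excess from it then leaves
      exactly \<open>d\<close> times the indicator.\<close>
    define \<eta> where "\<eta> = d / \<delta>"
    have \<eta>: "\<eta> > 0" "\<eta> * \<delta> = d" using d \<delta> by (auto simp: \<eta>_def)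
    have "(\<lambda>x. \<eta> * f x) \<notin> C\<^sub>c\<^sub>l"
    proof
      assume "(\<lambda>x. \<eta> * f x) \<in> C\<^sub>c\<^sub>l"
      moreover have "L1_norm \<Omega> \<A> lam (\<lambda>x. \<eta> * \<bar>f x\<bar> - \<eta> * f x) = 0"
        using L1_norm_null_eq[OF fL L1_abs[OF fL] null]
          L1_norm_cmult[OF L1_diff[OF fL L1_abs[OF fL]], of "- \<eta>"] by (simp add: algebra_simps)
      ultimately have abs: "(\<lambda>x. \<eta> * \<bar>f x\<bar>) \<in> C\<^sub>c\<^sub>l"
        unfolding C\<^sub>c\<^sub>l_def
        by (intro L1_closure_norm_eq[OF minus_simple_subset_L1[OF K] _ L1_cmult[OF L1_abs[OF fL]]])
      have "0 \<le> \<eta> * \<bar>f x\<bar> - d * indicator A x" for x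
        using \<delta>(2)[of x] mult_left_mono[of \<delta> "\<bar>f x\<bar>" \<eta>] \<eta> by (auto simp: indicator_def)
      then have "(\<lambda>x. \<eta> * \<bar>f x\<bar> - (\<eta> * \<bar>f x\<bar> - d * indicator A x)) \<in> C\<^sub>c\<^sub>l"
        using abs unfolding C\<^sub>c\<^sub>l_def
        by (intro L1_closure_minus_nonneg[OF K] L1_diff L1_cmult[OF L1_abs[OF fL]] ind A(1)) auto
      then show False using d(2) by simp
    qed
    then show "\<exists>\<eta>>0. (\<lambda>x. \<eta> * f x) \<notin> C\<^sub>c\<^sub>l" using \<eta>(1) by blast
  qed
  moreover have "cond_ii \<Longrightarrow> cond_iii"
  proof -
    assume ii: "cond_ii"
    have ex: "\<exists>\<phi> c. dominated_functional \<phi> c \<and> bdd_above (\<phi> ` K) \<and> \<phi> (indicator A) > 0"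
      if A: "A \<in> \<A>" "lam A > 0" for A
    proof -
      obtain d where d: "d > 0" "(\<lambda>x. d * indicator A x) \<notin> C\<^sub>c\<^sub>l" using ii A by (auto simp: cond_ii_def)
      obtain \<phi> c where \<phi>: "dominated_functional \<phi> c" "bdd_above (\<phi> ` K)" "\<phi> (\<lambda>x. d * indicator A x) > 0"
        by (rule separating_functional[OF K assms(6) z ind[OF A(1)] d(2)[unfolded C\<^sub>c\<^sub>l_def]])
      then have "\<phi> (indicator A) > 0"
        unfolding dominated_functional_cmult[OF \<phi>(1) L1_simple[OF simple_indicator[OF A(1)]]]
        using d(1) zero_less_mult_pos by blast
      then show ?thesis using \<phi> by blast
    qed
    obtain \<phi> c where \<phi>: "dominated_functional \<phi> c" "bdd_above (\<phi> ` K)"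
      and charge: "\<And>A. A \<in> \<A> \<Longrightarrow> lam A > 0 \<Longrightarrow> \<phi> (indicator A) > 0"
      by (rule charging_functional[OF K assms(4) ex], assumption+, rule that)
    \<comment> \<open>Since \<open>lam \<Omega> > 0\<close>, the functional charges \<Omega>, and
      normalising to total mass 1 divides by a positive number.\<close>
    define a where "a = 1 / \<phi> (indicator \<Omega>)"
    define P where "P = (\<lambda>A. a * \<phi> (indicator A))"
    have a: "a > 0" using charge[OF top assms(4)] by (simp add: a_def)
    have \<psi>: "dominated_functional (\<lambda>f. a * \<phi> f) (a * c)"
      using dominated_functional_scale[OF \<phi>(1)] a by simp
    have P: "P \<in> ba_pos \<A>" and le: "\<And>A. A \<in> \<A> \<Longrightarrow> P A \<le> a * c * lam A"
      and int: "\<And>f. f \<in> integrable\<^sub>f \<Longrightarrow> f \<in> L1 \<Omega> \<A> P \<and> fa_integral \<Omega> \<A> P f = a * \<phi> f"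
      unfolding P_def by (fact dominated_functional_ba_pos[OF \<psi>], fact dominated_functional_indicator_le[OF \<psi>],
        intro conjI dominated_functional_integral[OF \<psi>])
    have "fa_prob \<Omega> \<A> P"
      using P charge[OF top assms(4)] by (simp add: fa_prob_def P_def a_def)
    moreover have "K \<subseteq> L1 \<Omega> \<A> P" using K int by blast
    moreover have "bdd_above (fa_integral \<Omega> \<A> P ` K)"
    proof -
      obtain b where "\<And>k. k \<in> K \<Longrightarrow> \<phi> k \<le> b" using \<phi>(2) by (auto simp: bdd_above_def)
      then show ?thesis using K int a by (intro bdd_aboveI2[where M = "a * b"]) (auto simp: subset_iff)
    qed
    moreover have "bdd_above {P A / lam A | A. A \<in> \<A> \<and> lam A > 0}"
      using le by (intro bdd_aboveI[where M = "a * c"]) (auto simp: divide_le_eq)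
    moreover have "P A = 0 \<longleftrightarrow> lam A = 0" if A: "A \<in> \<A>" for A
    proof (cases "lam A = 0")
      case True
      then show ?thesis using le[OF A] P A by (auto simp: ba_pos_def intro: antisym)
    next
      case False
      then show ?thesis using charge[OF A] lam_pos[OF A] a by (auto simp: P_def)
    qed
    ultimately show ?thesis unfolding cond_iii_def by blast
  qed
  moreover have "cond_iii \<Longrightarrow> cond_ii"
  proof -
    assume "cond_iii"
    then obtain P where P: "fa_prob \<Omega> \<A> P" and KP: "K \<subseteq> L1 \<Omega> \<A> P"
      and bdd: "bdd_above (fa_integral \<Omega> \<A> P ` K)"
      and ratio: "bdd_above {P A / lam A | A. A \<in> \<A> \<and> lam A > 0}"
      and null: "\<forall>A\<in>\<A>. P A = 0 \<longleftrightarrow> lam A = 0"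
      unfolding cond_iii_def by blast
    have ba: "P \<in> ba_pos \<A>" using P by (simp add: fa_prob_def)
    then interpret P: finitely_additive \<Omega> \<A> P by (simp add: finitely_additive_iff)
    obtain b where b: "\<And>k. k \<in> K \<Longrightarrow> fa_integral \<Omega> \<A> P k \<le> b" using bdd by (auto simp: bdd_above_def)
    obtain c0 where c0: "\<And>A. A \<in> \<A> \<Longrightarrow> lam A > 0 \<Longrightarrow> P A / lam A \<le> c0"
      using ratio unfolding bdd_above_def by blast
    define c where "c = max 1 c0"
    have c: "c > 0" by (simp add: c_def)
    \<comment> \<open>The ratio bound speaks of sets with \<open>lam A > 0\<close> only; on the
      remaining sets (c) gives \<open>P A = 0\<close>.\<close>
    have dom: "P A \<le> c * lam A" if A: "A \<in> \<A>" for A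
    proof (cases "lam A > 0")
      case True
      then have "P A \<le> c0 * lam A" using c0[OF A] by (simp add: divide_le_eq)
      also have "\<dots> \<le> c * lam A" using True by (simp add: c_def)
      finally show ?thesis .
    next
      case False
      then show ?thesis using lam_pos[OF A] null A by auto
    qed
    have norm_le: "f \<in> L1 \<Omega> \<A> P \<and> L1_norm \<Omega> \<A> P f \<le> c * L1_norm \<Omega> \<A> lam f" if "f \<in> integrable\<^sub>f" for f
      using that determining_dominated[OF ba c dom] L1_norm_dominated[OF ba c dom] unfolding L1_def by blast
    show cond_ii
      unfolding cond_ii_def
    proof (intro ballI impI, rule ccontr)
      fix A assume A: "A \<in> \<A>" "lam A > 0" and contra: "\<not> (\<exists>d>0. (\<lambda>x. d * indicator A x) \<notin> C\<^sub>c\<^sub>l)"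
      have PA: "P A > 0" using P.measure_nonneg[OF A(1)] null A by (metis less_irrefl order_le_less)
      \<comment> \<open>Approximation within distance 1 costs at most \<open>c\<close> under
        \<open>P\<close>, the part from \<open>K\<close> integrates to at most \<open>b\<close>, and
        the subtracted simple function only helps. The bound does not depend on \<open>d\<close>,
        which can therefore be taken too large.\<close>
      have "d * P A \<le> b + c" if d: "d > 0" for d
      proof -
        let ?g = "\<lambda>x. d * indicator A x :: real"
        have "?g \<in> C\<^sub>c\<^sub>l" using contra d by blast
        then obtain h where h: "h \<in> minus_simple \<Omega> \<A> K" "L1_norm \<Omega> \<A> lam (\<lambda>x. ?g x - h x) < 1"
          unfolding C\<^sub>c\<^sub>l_def L1_closure_def mem_Collect_eq using zero_less_one by blast
        obtain k s where k: "k \<in> K" and s: "s \<in> simple_fun_pos \<Omega> \<A>" and hks: "h = (\<lambda>x. k x - s x)"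
          using h(1) unfolding minus_simple_def by blast
        note ks = h(2)[unfolded hks]
        have sL: "s \<in> integrable\<^sub>f" "s \<in> L1 \<Omega> \<A> P" and kL: "k \<in> integrable\<^sub>f" "k \<in> L1 \<Omega> \<A> P"
          using s k K KP L1_simple P.L1_simple by (auto simp: simple_fun_pos_iff)
        have gL: "?g \<in> L1 \<Omega> \<A> P" by (rule P.L1_cmult[OF P.L1_simple[OF simple_indicator[OF A(1)]]])
        note diff = L1_diff[OF ind[OF A(1), of d] L1_diff[OF kL(1) sL(1)]]
        have "fa_integral \<Omega> \<A> P ?g - (fa_integral \<Omega> \<A> P k - fa_integral \<Omega> \<A> P s)
            = fa_integral \<Omega> \<A> P (\<lambda>x. ?g x - (k x - s x))"
          using P.fa_integral_diff[OF gL P.L1_diff[OF kL(2) sL(2)]] P.fa_integral_diff[OF kL(2) sL(2)] by simp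
        also have "\<dots> \<le> L1_norm \<Omega> \<A> P (\<lambda>x. ?g x - (k x - s x))"
          using P.abs_fa_integral_le norm_le[OF diff] by (meson abs_le_D1)
        also have "\<dots> \<le> c * L1_norm \<Omega> \<A> lam (\<lambda>x. ?g x - (k x - s x))" using norm_le[OF diff] by simp
        also have "\<dots> \<le> c * 1" using ks c by (intro mult_left_mono) auto
        finally have "fa_integral \<Omega> \<A> P ?g \<le> b + c - fa_integral \<Omega> \<A> P s" using b[OF k] by simp
        moreover have "0 \<le> fa_integral \<Omega> \<A> P s"
          using s by (intro P.fa_integral_nonneg sL) (auto simp: simple_fun_pos_iff)
        moreover have "fa_integral \<Omega> \<A> P ?g = d * P A"
          using P.fa_integral_cmult[OF P.L1_simple[OF simple_indicator[OF A(1)]], of d]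
            P.fa_integral_simple[OF simple_indicator[OF A(1)]] P.sint_indicator[OF A(1)] by simp
        ultimately show ?thesis by linarith
      qed
      \<comment> \<open>This \<open>d\<close> makes the left side
        \<open>\<bar>b + c\<bar> + 1\<close>.\<close>
      from this[of "(\<bar>b + c\<bar> + 1) / P A"] PA show False by (simp add: divide_pos_pos)
    qed
  qed
  ultimately show ?thesis by blast
qed

end
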